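(* Let $A$ be a finite dimensional (not necessarily associative) algebra with a generalized $H$-action for some associative algebra $H$ with $1$ over a field $F$ of characteristic $0$. Then $$\ell_n^H(A)\le (\dim A)(n+1)^{(\dim A)^2+\dim A}$$ for all $n\in\mathbb N$.
   Context: Algebras are not necessarily associative unless stated otherwise; $\mathbb N$ is the set of positive integers. Let $F$ be a field and $H$ an associative $F$-algebra with $1$. An algebra $A$ over $F$ is an algebra with a generalized $H$-action if $A$ is a left $H$-module and for every $h\in H$ there exist $k\in\mathbb N$ and $h'_i,h''_i,h'''_i,h''''_i\in H$ ($1\le i\le k$) such that $h(ab)=\sum_{i=1}^k\bigl((h'_i a)(h''_i b)+(h'''_i b)(h''''_i a)\bigr)$ for all $a,b\in A$. $H$-polynomials: let $X=\{x_1,x_2,\dots\}$ and let $F\{X\}=\bigoplus_{n\ge1}F\{X\}^{(n)}$ be the absolutely free non-associative $F$-algebra on $X$, graded by total degree. Put $F\{X|H\}:=\bigoplus_{n\ge 1}H^{\otimes n}\otimes F\{X\}^{(n)}$ with multiplication $(u_1\otimes w_1)(u_2\otimes w_2):=(u_1\otimes u_2)\otimes w_1w_2$. Write $x_{i_1}^{h_1}\cdots x_{i_n}^{h_n}:=(h_1\otimes\cdots\otimes h_n)\otimes x_{i_1}\cdots x_{i_n}$ (same bracket arrangement) and identify $x_i$ with $x_i^{1_H}$. Every map $\psi\colon X\to A$ extends uniquely to an algebra homomorphism $\bar\psi\colon F\{X|H\}\to A$ with $\bar\psi(x_i^h)=h\psi(x_i)$; $f\in F\{X|H\}$ is a polynomial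 $H$-identity of $A$ if $\bar\psi(f)=0$ for all $\psi$. The ideal of polynomial $H$-identities is $\mathrm{Id}^H(A)$. Let $W_n^H$ be the span of all $x_{\sigma(1)}^{h_1}\cdots x_{\sigma(n)}^{h_n}$ with $h_i\in H$, $\sigma\in S_n$ and all arrangements of brackets. The group $S_n$ acts on $\frac{W_n^H}{W_n^H\cap \mathrm{Id}^H(A)}$ by permuting the variables $x_1,\dots,x_n$; $m(A,H,\lambda)$ denotes the multiplicity in it of the irreducible $FS_n$-module $M(\lambda)$ corresponding to $\lambda\vdash n$. The $n$th colength of polynomial $H$-identities of $A$ is $\ell_n^H(A):=\sum_{\lambda\vdash n}m(A,H,\lambda)$. *)

theory Defs
  imports Complex_Main "HOL-Library.Poly_Mapping" "HOL-Combinatorics.Permutations"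
begin

section \<open>Algebras with a generalized action\<close>

text \<open>
  The algebra \<open>A\<close> is the type \<open>'a\<close> with scalar multiplication \<open>sA\<close> and product \<open>mul\<close>, which is
  only bilinear. The sort of \<open>'h\<close> is used instead of \<^class>\<open>ring_1\<close> so that \<open>1 = 0\<close> is allowed
  in \<open>H\<close>.
\<close>

locale generalized_H_action =
  H: vector_space sH + A: vector_space sA
  for sH :: "'f::field \<Rightarrow> 'h::{ring,monoid_mult} \<Rightarrow> 'h"
    and sA :: "'f \<Rightarrow> 'a::ab_group_add \<Rightarrow> 'a" +
  fixes mul :: "'a \<Rightarrow> 'a \<Rightarrow> 'a"
    and hact :: "'h \<Rightarrow> 'a \<Rightarrow> 'a"
  assumes H_scale_left: "sH c g * h = sH c (g * h)"
    and H_scale_right: "g * sH c h = sH c (g * h)"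
    and mul_add_left: "mul (a + a') b = mul a b + mul a' b"
    and mul_add_right: "mul a (b + b') = mul a b + mul a b'"
    and mul_scale_left: "mul (sA c a) b = sA c (mul a b)"
    and mul_scale_right: "mul a (sA c b) = sA c (mul a b)"
    and hact_one: "hact 1 a = a"
    and hact_mult: "hact (g * h) a = hact g (hact h a)"
    and hact_add_left: "hact (g + h) a = hact g a + hact h a"
    and hact_add_right: "hact h (a + b) = hact h a + hact h b"
    and hact_scale_left: "hact (sH c h) a = sA c (hact h a)"
    and hact_scale_right: "hact h (sA c a) = sA c (hact h a)"
    and hact_mul: "\<exists>k\<ge>1. \<exists>h1 h2 h3 h4 :: nat \<Rightarrow> 'h. \<forall>a b.
      hact h (mul a b) =
        (\<Sum>i=1..k. mul (hact (h1 i) a) (hact (h2 i) b) + mul (hact (h3 i) b) (hact (h4 i) a))"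


section \<open>Vector spaces with permutations acting on them\<close>

text \<open>
  The carrier is explicit because quotient spaces are sets of cosets. Permutations of
  \<open>{..<n}\<close> are functions on \<^typ>\<open>nat\<close> fixing everything outside \<open>{..<n}\<close>, so that one record
  serves for all symmetric groups: for an \<open>F S\<^sub>n\<close>-module only \<open>act \<sigma>\<close> with \<open>\<sigma> permutes {..<n}\<close>
  matters.
\<close>

record ('f, 'v) perm_module =
  carrier :: "'v set"
  add :: "'v \<Rightarrow> 'v \<Rightarrow> 'v"
  zero :: 'v
  smul :: "'f \<Rightarrow> 'v \<Rightarrow> 'v"
  act :: "(nat \<Rightarrow> nat) \<Rightarrow> 'v \<Rightarrow> 'v"

definition is_subspace :: "('f, 'v) perm_module \<Rightarrow> 'v set \<Rightarrow> bool" where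
  "is_subspace V U \<longleftrightarrow> U \<subseteq> carrier V \<and> zero V \<in> U \<and>
     (\<forall>u\<in>U. \<forall>v\<in>U. add V u v \<in> U) \<and> (\<forall>c. \<forall>u\<in>U. smul V c u \<in> U)"

definition span_in :: "('f, 'v) perm_module \<Rightarrow> 'v set \<Rightarrow> 'v set" where
  "span_in V S = \<Inter> {U. is_subspace V U \<and> S \<subseteq> U}"

definition is_submodule :: "nat \<Rightarrow> ('f, 'v) perm_module \<Rightarrow> 'v set \<Rightarrow> bool" where
  "is_submodule n V U \<longleftrightarrow> is_subspace V U \<and> (\<forall>\<sigma>. \<sigma> permutes {..<n} \<longrightarrow> (\<forall>u\<in>U. act V \<sigma> u \<in> U))"

definition coset :: "('f, 'v) perm_module \<Rightarrow> 'v set \<Rightarrow> 'v \<Rightarrow> 'v set" where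
  "coset V U v = {add V v u | u. u \<in> U}"

text \<open>
  Adding \<open>U\<close> in the scalar multiplication makes \<open>0 \<cdot> C = U\<close>. No such correction is needed for
  the action: the image of a coset of an invariant subspace under a permutation is a coset.
\<close>

definition quotient :: "('f, 'v) perm_module \<Rightarrow> 'v set \<Rightarrow> ('f, 'v set) perm_module" where
  "quotient V U =
     \<lparr>carrier = coset V U ` carrier V,
      add = (\<lambda>C D. {add V c d | c d. c \<in> C \<and> d \<in> D}),
      zero = U,
      smul = (\<lambda>a C. {add V (smul V a c) u | c u. c \<in> C \<and> u \<in> U}),
      act = (\<lambda>\<sigma> C. act V \<sigma> ` C)\<rparr>"

definition is_irreducible :: "nat \<Rightarrow> ('f, 'v) perm_module \<Rightarrow> 'v set \<Rightarrow> bool" where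
  "is_irreducible n V U \<longleftrightarrow> is_submodule n V U \<and> U \<noteq> {zero V} \<and>
     (\<forall>T. is_submodule n V T \<and> T \<subseteq> U \<longrightarrow> T = {zero V} \<or> T = U)"

definition isomorphic :: "nat \<Rightarrow> ('f, 'v) perm_module \<Rightarrow> ('f, 'w) perm_module \<Rightarrow> bool" where
  "isomorphic n V W \<longleftrightarrow> (\<exists>\<phi>. bij_betw \<phi> (carrier V) (carrier W) \<and>
     (\<forall>u\<in>carrier V. \<forall>v\<in>carrier V. \<phi> (add V u v) = add W (\<phi> u) (\<phi> v)) \<and>
     (\<forall>c. \<forall>v\<in>carrier V. \<phi> (smul V c v) = smul W c (\<phi> v)) \<and>
     (\<forall>\<sigma>. \<sigma> permutes {..<n} \<longrightarrow> (\<forall>v\<in>carrier V. \<phi> (act V \<sigma> v) = act W \<sigma> (\<phi> v))))"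

text \<open>\<open>V = U\<^sub>1 \<oplus> \<dots> \<oplus> U\<^sub>k\<close> with irreducible submodules \<open>U\<^sub>1, \<dots>, U\<^sub>k\<close>.\<close>

definition is_decomposition :: "nat \<Rightarrow> ('f, 'v) perm_module \<Rightarrow> 'v set list \<Rightarrow> bool" where
  "is_decomposition n V Us \<longleftrightarrow> (\<forall>U\<in>set Us. is_irreducible n V U) \<and>
     (\<forall>v\<in>carrier V. \<exists>!us. list_all2 (\<in>) us Us \<and> foldr (add V) us (zero V) = v)"

text \<open>
  For a finite dimensional \<open>V\<close> in characteristic \<open>0\<close> a decomposition exists by Maschke's theorem,
  and by the Krull--Schmidt theorem the number of summands isomorphic to \<open>M\<close> does not depend on
  the choice.
\<close>

definition multiplicity :: "nat \<Rightarrow> ('f, 'v) perm_module \<Rightarrow> ('f, 'w) perm_module \<Rightarrow> nat" where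
  "multiplicity n V M =
     (let Us = SOME Us. is_decomposition n V Us
      in length (filter (\<lambda>U. isomorphic n (V\<lparr>carrier := U\<rparr>) M) Us))"


section \<open>Free vector spaces\<close>

definition pm_scale :: "'f::field \<Rightarrow> ('k \<Rightarrow>\<^sub>0 'f) \<Rightarrow> 'k \<Rightarrow>\<^sub>0 'f" where
  "pm_scale c p = Poly_Mapping.map ((*) c) p"

text \<open>The linear extension of a map \<open>g\<close> defined on the basis, where \<open>s\<close> is the scalar
  multiplication of the target.\<close>

definition lin_ext :: "('f::field \<Rightarrow> 'v::ab_group_add \<Rightarrow> 'v) \<Rightarrow> ('k \<Rightarrow> 'v) \<Rightarrow> ('k \<Rightarrow>\<^sub>0 'f) \<Rightarrow> 'v" where
  "lin_ext s g p = (\<Sum>k\<in>Poly_Mapping.keys p. s (Poly_Mapping.lookup p k) (g k))"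


section \<open>The irreducible modules of the symmetric group\<close>

definition partitions :: "nat \<Rightarrow> nat list set" where
  "partitions n = {\<mu>. sorted_wrt (\<ge>) \<mu> \<and> (\<forall>k\<in>set \<mu>. 0 < k) \<and> sum_list \<mu> = n}"

text \<open>
  The position of \<open>j\<close> in the Young tableau \<open>T\<^sub>\<mu>\<close> of shape \<open>\<mu>\<close> that is filled with \<open>0, 1, 2, \<dots>\<close>
  row by row.
\<close>

fun row_of :: "nat list \<Rightarrow> nat \<Rightarrow> nat" where
  "row_of [] j = 0"
| "row_of (k # ks) j = (if j < k then 0 else Suc (row_of ks (j - k)))"

fun col_of :: "nat list \<Rightarrow> nat \<Rightarrow> nat" where
  "col_of [] j = 0"
| "col_of (k # ks) j = (if j < k then j else col_of ks (j - k))"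

definition row_stabilizer :: "nat list \<Rightarrow> (nat \<Rightarrow> nat) set" where
  "row_stabilizer \<mu> = {\<pi>. \<pi> permutes {..<sum_list \<mu>} \<and>
     (\<forall>j<sum_list \<mu>. row_of \<mu> (\<pi> j) = row_of \<mu> j)}"

definition col_stabilizer :: "nat list \<Rightarrow> (nat \<Rightarrow> nat) set" where
  "col_stabilizer \<mu> = {\<pi>. \<pi> permutes {..<sum_list \<mu>} \<and>
     (\<forall>j<sum_list \<mu>. col_of \<mu> (\<pi> j) = col_of \<mu> j)}"

text \<open>The elements of the group algebra \<open>F S\<^sub>n\<close> are the \<open>x\<close> with
  \<open>Poly_Mapping.keys x \<subseteq> {\<sigma>. \<sigma> permutes {..<n}}\<close>.\<close>

definition group_mult ::
  "((nat \<Rightarrow> nat) \<Rightarrow>\<^sub>0 'f::field) \<Rightarrow> ((nat \<Rightarrow> nat) \<Rightarrow>\<^sub>0 'f) \<Rightarrow> (nat \<Rightarrow> nat) \<Rightarrow>\<^sub>0 'f" where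
  "group_mult x y =
     lin_ext pm_scale (\<lambda>\<sigma>. lin_ext pm_scale (\<lambda>\<tau>. Poly_Mapping.single (\<sigma> \<circ> \<tau>) 1) y) x"

definition young_symmetrizer :: "nat list \<Rightarrow> (nat \<Rightarrow> nat) \<Rightarrow>\<^sub>0 'f::field" where
  "young_symmetrizer \<mu> =
     group_mult (\<Sum>\<pi>\<in>row_stabilizer \<mu>. Poly_Mapping.single \<pi> 1)
                (\<Sum>\<pi>\<in>col_stabilizer \<mu>. Poly_Mapping.single \<pi> (of_int (sign \<pi>)))"

text \<open>\<open>M(\<mu>) = F S\<^sub>n e\<close> for the Young symmetrizer \<open>e\<close> of \<open>T\<^sub>\<mu>\<close>.\<close>

definition irreducible_module :: "nat list \<Rightarrow> ('f::field, (nat \<Rightarrow> nat) \<Rightarrow>\<^sub>0 'f) perm_module" where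
  "irreducible_module \<mu> =
     \<lparr>carrier = {group_mult x (young_symmetrizer \<mu>)
        | x. Poly_Mapping.keys x \<subseteq> {\<sigma>. \<sigma> permutes {..<sum_list \<mu>}}},
      add = (+), zero = 0, smul = pm_scale,
      act = (\<lambda>\<sigma>. group_mult (Poly_Mapping.single \<sigma> 1))\<rparr>"


section \<open>\<open>H\<close>-polynomials\<close>

text \<open>Non-associative words; these form the basis of \<open>F{X}\<close>. The index \<open>i\<close> stands for the variable
  \<open>x\<^sub>i\<^sub>+\<^sub>1\<close>.\<close>

datatype 'x nonassoc_word = Var 'x | Prod "'x nonassoc_word" "'x nonassoc_word"

fun letters :: "'x nonassoc_word \<Rightarrow> 'x list" where
  "letters (Var i) = [i]"
| "letters (Prod u v) = letters u @ letters v"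

abbreviation word_degree :: "'x nonassoc_word \<Rightarrow> nat" where
  "word_degree w \<equiv> length (letters w)"

text \<open>
  The words of degree \<open>n\<close> form a basis of \<open>F{X}\<^sup>(\<^sup>n\<^sup>)\<close>, so the sum over all \<open>n\<close> of
  \<open>H\<^sup>\<otimes>\<^sup>n \<otimes> F{X}\<^sup>(\<^sup>n\<^sup>)\<close> is the free vector space on the pairs \<open>([h\<^sub>1,\<dots>,h\<^sub>n], w)\<close> with \<open>w\<close> of degree \<open>n\<close>
  modulo multilinearity in \<open>h\<^sub>1,\<dots>,h\<^sub>n\<close>. Permutations act by renaming the variables.
\<close>

type_synonym 'h hmonomial = "'h list \<times> nat nonassoc_word"

definition free_hpoly :: "('f::field, 'h hmonomial \<Rightarrow>\<^sub>0 'f) perm_module" where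
  "free_hpoly =
     \<lparr>carrier = {p. \<forall>(hs, w)\<in>Poly_Mapping.keys p. length hs = word_degree w},
      add = (+), zero = 0, smul = pm_scale,
      act = (\<lambda>\<sigma>. lin_ext pm_scale (\<lambda>(hs, w). Poly_Mapping.single (hs, map_nonassoc_word \<sigma> w) 1))\<rparr>"

definition multilinearity ::
  "('f::field \<Rightarrow> 'h::{ring,monoid_mult} \<Rightarrow> 'h) \<Rightarrow> ('h hmonomial \<Rightarrow>\<^sub>0 'f) set" where
  "multilinearity sH = span_in free_hpoly
     ({Poly_Mapping.single (hs[i := g + h], w) 1 - Poly_Mapping.single (hs[i := g], w) 1
         - Poly_Mapping.single (hs[i := h], w) 1
       | hs w i g h. length hs = word_degree w \<and> i < length hs} \<union>
      {Poly_Mapping.single (hs[i := sH c h], w) 1 - Poly_Mapping.single (hs[i := h], w) c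
       | hs w i c h. length hs = word_degree w \<and> i < length hs})"

text \<open>\<open>F{X|H}\<close>; its product is \<open>hpoly_mult\<close> below.\<close>

definition hpoly ::
  "('f::field \<Rightarrow> 'h::{ring,monoid_mult} \<Rightarrow> 'h) \<Rightarrow> ('f, ('h hmonomial \<Rightarrow>\<^sub>0 'f) set) perm_module" where
  "hpoly sH = quotient free_hpoly (multilinearity sH)"

text \<open>\<open>(h\<^sub>1 \<otimes> \<dots> \<otimes> h\<^sub>n) \<otimes> w\<close>\<close>

definition hmon ::
  "('f::field \<Rightarrow> 'h::{ring,monoid_mult} \<Rightarrow> 'h) \<Rightarrow> 'h list \<Rightarrow> nat nonassoc_word \<Rightarrow>
   ('h hmonomial \<Rightarrow>\<^sub>0 'f) set" where
  "hmon sH hs w = coset free_hpoly (multilinearity sH) (Poly_Mapping.single (hs, w) 1)"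

definition free_hpoly_mult ::
  "('h hmonomial \<Rightarrow>\<^sub>0 'f::field) \<Rightarrow> ('h hmonomial \<Rightarrow>\<^sub>0 'f) \<Rightarrow> 'h hmonomial \<Rightarrow>\<^sub>0 'f" where
  "free_hpoly_mult p q =
     lin_ext pm_scale (\<lambda>(gs, u).
       lin_ext pm_scale (\<lambda>(hs, v). Poly_Mapping.single (gs @ hs, Prod u v) 1) q) p"

definition hpoly_mult ::
  "('f::field \<Rightarrow> 'h::{ring,monoid_mult} \<Rightarrow> 'h) \<Rightarrow>
   ('h hmonomial \<Rightarrow>\<^sub>0 'f) set \<Rightarrow> ('h hmonomial \<Rightarrow>\<^sub>0 'f) set \<Rightarrow> ('h hmonomial \<Rightarrow>\<^sub>0 'f) set" where
  "hpoly_mult sH C D =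
     {free_hpoly_mult p q + r | p q r. p \<in> C \<and> q \<in> D \<and> r \<in> multilinearity sH}"

fun hmon_value ::
  "('a \<Rightarrow> 'a \<Rightarrow> 'a) \<Rightarrow> ('h \<Rightarrow> 'a \<Rightarrow> 'a) \<Rightarrow> (nat \<Rightarrow> 'a) \<Rightarrow> 'h list \<Rightarrow> nat nonassoc_word \<Rightarrow> 'a" where
  "hmon_value mul hact \<psi> hs (Var i) = hact (hd hs) (\<psi> i)"
| "hmon_value mul hact \<psi> hs (Prod u v) =
     mul (hmon_value mul hact \<psi> (take (word_degree u) hs) u)
         (hmon_value mul hact \<psi> (drop (word_degree u) hs) v)"

definition free_hpoly_value ::
  "('f::field \<Rightarrow> 'a::ab_group_add \<Rightarrow> 'a) \<Rightarrow> ('a \<Rightarrow> 'a \<Rightarrow> 'a) \<Rightarrow> ('h \<Rightarrow> 'a \<Rightarrow> 'a) \<Rightarrow>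
   (nat \<Rightarrow> 'a) \<Rightarrow> ('h hmonomial \<Rightarrow>\<^sub>0 'f) \<Rightarrow> 'a" where
  "free_hpoly_value sA mul hact \<psi> = lin_ext sA (\<lambda>(hs, w). hmon_value mul hact \<psi> hs w)"

text \<open>
  The homomorphism from \<open>F{X|H}\<close> to \<open>A\<close> that extends \<open>\<psi>\<close>. All representatives of an element of
  \<open>F{X|H}\<close> have the same value; see \<open>hpoly_value_coset\<close> and the lemmas after it.
\<close>

definition hpoly_value ::
  "('f::field \<Rightarrow> 'a::ab_group_add \<Rightarrow> 'a) \<Rightarrow> ('a \<Rightarrow> 'a \<Rightarrow> 'a) \<Rightarrow> ('h \<Rightarrow> 'a \<Rightarrow> 'a) \<Rightarrow>
   (nat \<Rightarrow> 'a) \<Rightarrow> ('h hmonomial \<Rightarrow>\<^sub>0 'f) set \<Rightarrow> 'a" where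
  "hpoly_value sA mul hact \<psi> C = the_elem (free_hpoly_value sA mul hact \<psi> ` C)"

definition hidentities ::
  "('f::field \<Rightarrow> 'h::{ring,monoid_mult} \<Rightarrow> 'h) \<Rightarrow> ('f \<Rightarrow> 'a::ab_group_add \<Rightarrow> 'a) \<Rightarrow>
   ('a \<Rightarrow> 'a \<Rightarrow> 'a) \<Rightarrow> ('h \<Rightarrow> 'a \<Rightarrow> 'a) \<Rightarrow> ('h hmonomial \<Rightarrow>\<^sub>0 'f) set set" where
  "hidentities sH sA mul hact =
     {f \<in> carrier (hpoly sH). \<forall>\<psi>. hpoly_value sA mul hact \<psi> f = 0}"

text \<open>\<open>W\<^sub>n\<^sup>H\<close>\<close>

definition multilinear_hpolys ::
  "('f::field \<Rightarrow> 'h::{ring,monoid_mult} \<Rightarrow> 'h) \<Rightarrow> nat \<Rightarrow> ('h hmonomial \<Rightarrow>\<^sub>0 'f) set set" where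
  "multilinear_hpolys sH n = span_in (hpoly sH)
     {hmon sH hs w | hs w. length hs = n \<and> (\<exists>\<sigma>. \<sigma> permutes {..<n} \<and> letters w = map \<sigma> [0..<n])}"

definition cocharacter_module ::
  "('f::field \<Rightarrow> 'h::{ring,monoid_mult} \<Rightarrow> 'h) \<Rightarrow> ('f \<Rightarrow> 'a::ab_group_add \<Rightarrow> 'a) \<Rightarrow>
   ('a \<Rightarrow> 'a \<Rightarrow> 'a) \<Rightarrow> ('h \<Rightarrow> 'a \<Rightarrow> 'a) \<Rightarrow> nat \<Rightarrow> ('f, ('h hmonomial \<Rightarrow>\<^sub>0 'f) set set) perm_module" where
  "cocharacter_module sH sA mul hact n =
     quotient ((hpoly sH)\<lparr>carrier := multilinear_hpolys sH n\<rparr>)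
       (multilinear_hpolys sH n \<inter> hidentities sH sA mul hact)"

definition colength ::
  "('f::field \<Rightarrow> 'h::{ring,monoid_mult} \<Rightarrow> 'h) \<Rightarrow> ('f \<Rightarrow> 'a::ab_group_add \<Rightarrow> 'a) \<Rightarrow>
   ('a \<Rightarrow> 'a \<Rightarrow> 'a) \<Rightarrow> ('h \<Rightarrow> 'a \<Rightarrow> 'a) \<Rightarrow> nat \<Rightarrow> nat" where
  "colength sH sA mul hact n =
     (\<Sum>\<mu>\<in>partitions n. multiplicity n (cocharacter_module sH sA mul hact n) (irreducible_module \<mu>))"


section \<open>Evaluation is the algebra homomorphism extending the substitution\<close>

lemma lookup_pm_scale [simp]: "Poly_Mapping.lookup (pm_scale c p) k = c * Poly_Mapping.lookup p k"
  by (simp add: pm_scale_def map.rep_eq when_def)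

lemma vector_space_pm_scale: "vector_space pm_scale"
  by unfold_locales (auto intro!: poly_mapping_eqI simp: lookup_add algebra_simps)

lemma lin_ext_superset:
  assumes "vector_space s" "finite K" "Poly_Mapping.keys p \<subseteq> K"
  shows "lin_ext s g p = (\<Sum>k\<in>K. s (Poly_Mapping.lookup p k) (g k))"
proof -
  interpret vector_space s by fact
  show ?thesis unfolding lin_ext_def
    by (rule sum.mono_neutral_left) (use assms(2,3) in \<open>auto simp: in_keys_iff\<close>)
qed

lemma lin_ext_add:
  assumes "vector_space s"
  shows "lin_ext s g (p + q) = lin_ext s g p + lin_ext s g q"
proof -
  interpret vector_space s by fact
  let ?K = "Poly_Mapping.keys p \<union> Poly_Mapping.keys q"
  have "Poly_Mapping.keys (p + q) \<subseteq> ?K" by (rule keys_add)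
  then show ?thesis
    by (simp add: lin_ext_superset[OF assms, of ?K] lookup_add scale_left_distrib sum.distrib)
qed

lemma lin_ext_pm_scale:
  assumes "vector_space s"
  shows "lin_ext s g (pm_scale c p) = s c (lin_ext s g p)"
proof -
  interpret vector_space s by fact
  have "Poly_Mapping.keys (pm_scale c p) \<subseteq> Poly_Mapping.keys p" by (auto simp: in_keys_iff)
  then show ?thesis
    by (simp add: lin_ext_superset[OF assms, of "Poly_Mapping.keys p"] scale_sum_right)
qed

lemma lin_ext_single:
  assumes "vector_space s"
  shows "lin_ext s g (Poly_Mapping.single k c) = s c (g k)"
proof -
  interpret vector_space s by fact
  show ?thesis by (simp add: lin_ext_def)
qed

lemma lin_ext_zero [simp]: "lin_ext s g 0 = 0"
  by (simp add: lin_ext_def)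

lemma lin_ext_diff:
  assumes "vector_space s"
  shows "lin_ext s g (p - q) = lin_ext s g p - lin_ext s g q"
  using lin_ext_add[OF assms, of g "p - q" q] by (simp add: algebra_simps)

lemma lin_ext_sum:
  assumes "vector_space s"
  shows "lin_ext s g (sum f I) = (\<Sum>i\<in>I. lin_ext s g (f i))"
  by (induction I rule: infinite_finite_induct) (simp_all add: lin_ext_add[OF assms])

lemma image_eq_singleton:
  assumes "a \<in> C" "\<And>x. x \<in> C \<Longrightarrow> f x = y"
  shows "f ` C = {y}"
  using assms by auto

lemma zero_in_multilinearity: "0 \<in> multilinearity sH"
  unfolding multilinearity_def span_in_def is_subspace_def by (auto simp: free_hpoly_def)

context generalized_H_action
begin

lemma hmon_value_add:
  assumes "length hs = word_degree w" "i < length hs"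
  shows "hmon_value mul hact \<psi> (hs[i := g + h]) w =
         hmon_value mul hact \<psi> (hs[i := g]) w + hmon_value mul hact \<psi> (hs[i := h]) w"
  using assms
proof (induction w arbitrary: hs i)
  case (Var x)
  then show ?case by (cases hs) (auto simp: hact_add_left)
next
  case (Prod u v)
  show ?case
  proof (cases "i < word_degree u")
    case True
    then show ?thesis using Prod.prems Prod.IH(1)[of "take (word_degree u) hs" i]
      by (simp add: take_update_swap drop_update_cancel mul_add_left)
  next
    case False
    then show ?thesis
      using Prod.prems Prod.IH(2)[of "drop (word_degree u) hs" "i - word_degree u"]
      by (simp add: take_update_cancel drop_update_swap mul_add_right)
  qed
qed

lemma hmon_value_scale:
  assumes "length hs = word_degree w" "i < length hs"
  shows "hmon_value mul hact \<psi> (hs[i := sH c h]) w = sA c (hmon_value mul hact \<psi> (hs[i := h]) w)"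
  using assms
proof (induction w arbitrary: hs i)
  case (Var x)
  then show ?case by (cases hs) (auto simp: hact_scale_left)
next
  case (Prod u v)
  show ?case
  proof (cases "i < word_degree u")
    case True
    then show ?thesis using Prod.prems Prod.IH(1)[of "take (word_degree u) hs" i]
      by (simp add: take_update_swap drop_update_cancel mul_scale_left)
  next
    case False
    then show ?thesis
      using Prod.prems Prod.IH(2)[of "drop (word_degree u) hs" "i - word_degree u"]
      by (simp add: take_update_cancel drop_update_swap mul_scale_right)
  qed
qed

lemma multilinearity_subset:
  "multilinearity sH \<subseteq> {p \<in> carrier free_hpoly. free_hpoly_value sA mul hact \<psi> p = 0}"
proof -
  note lin = lin_ext_add[OF A.vector_space_axioms] lin_ext_diff[OF A.vector_space_axioms]
    lin_ext_pm_scale[OF A.vector_space_axioms] lin_ext_single[OF A.vector_space_axioms]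
  let ?U = "{p \<in> carrier free_hpoly. free_hpoly_value sA mul hact \<psi> p = 0}"
  have keys_diff': "k \<in> Poly_Mapping.keys p \<or> k \<in> Poly_Mapping.keys q" if "k \<in> Poly_Mapping.keys (p - q)"
    for k and p q :: "'h hmonomial \<Rightarrow>\<^sub>0 'f"
    using that by (auto simp: in_keys_iff lookup_minus)
  have "is_subspace free_hpoly ?U"
    unfolding is_subspace_def
    by (auto simp: free_hpoly_def free_hpoly_value_def lin dest!: subsetD[OF keys_add])
       (auto simp: in_keys_iff)
  moreover have "{Poly_Mapping.single (hs[i := g + h], w) 1 - Poly_Mapping.single (hs[i := g], w) 1
         - Poly_Mapping.single (hs[i := h], w) 1
       | hs w i g h. length hs = word_degree w \<and> i < length hs} \<subseteq> ?U"
    by (auto simp: free_hpoly_def free_hpoly_value_def lin hmon_value_add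
          dest!: keys_diff' split: if_splits)
  moreover have "{Poly_Mapping.single (hs[i := sH c h], w) 1 - Poly_Mapping.single (hs[i := h], w) c
       | hs w i c h. length hs = word_degree w \<and> i < length hs} \<subseteq> ?U"
    by (auto simp: free_hpoly_def free_hpoly_value_def lin hmon_value_scale
          dest!: keys_diff' split: if_splits)
  ultimately show ?thesis
    unfolding multilinearity_def span_in_def by (intro Inter_lower) simp
qed

lemma free_hpoly_value_multilinearity:
  "r \<in> multilinearity sH \<Longrightarrow> free_hpoly_value sA mul hact \<psi> r = 0"
  using multilinearity_subset by blast

lemma free_hpoly_value_add:
  "free_hpoly_value sA mul hact \<psi> (p + q) =
   free_hpoly_value sA mul hact \<psi> p + free_hpoly_value sA mul hact \<psi> q"
  by (simp add: free_hpoly_value_def lin_ext_add[OF A.vector_space_axioms])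

lemma hpoly_value_coset:
  "hpoly_value sA mul hact \<psi> (coset free_hpoly (multilinearity sH) p) =
   free_hpoly_value sA mul hact \<psi> p"
proof -
  let ?v = "free_hpoly_value sA mul hact \<psi>" and ?C = "coset free_hpoly (multilinearity sH) p"
  have "p + 0 \<in> ?C"
    using zero_in_multilinearity[of sH] unfolding coset_def by (auto simp: free_hpoly_def)
  moreover have "?v x = ?v p" if "x \<in> ?C" for x
    using that unfolding coset_def
    by (auto simp: free_hpoly_def free_hpoly_value_add free_hpoly_value_multilinearity)
  ultimately have "?v ` ?C = {?v p}" by (rule image_eq_singleton)
  then show ?thesis by (simp add: hpoly_value_def)
qed

lemma hpoly_value_representative:
  assumes "f \<in> carrier (hpoly sH)" "p \<in> f"
  shows "p \<in> carrier free_hpoly \<and> hpoly_value sA mul hact \<psi> f = free_hpoly_value sA mul hact \<psi> p"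
proof -
  obtain q where q: "q \<in> carrier free_hpoly" "f = coset free_hpoly (multilinearity sH) q"
    using assms(1) by (auto simp: hpoly_def quotient_def)
  obtain u where u: "u \<in> multilinearity sH" "p = q + u"
    using assms(2) q(2) by (auto simp: coset_def free_hpoly_def)
  have "u \<in> carrier free_hpoly" using u(1) multilinearity_subset by blast
  with q(1) u(2) have "p \<in> carrier free_hpoly"
    by (auto simp: free_hpoly_def dest!: subsetD[OF keys_add])
  then show ?thesis
    using u by (simp add: q(2) hpoly_value_coset free_hpoly_value_add free_hpoly_value_multilinearity)
qed

lemma hpoly_nonempty:
  assumes "f \<in> carrier (hpoly sH)"
  obtains p where "p \<in> f"
  using assms zero_in_multilinearity[of sH] that
  by (auto simp: hpoly_def quotient_def coset_def)

lemma hpoly_value_var: "hpoly_value sA mul hact \<psi> (hmon sH [h] (Var i)) = hact h (\<psi> i)"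
  by (simp add: hmon_def hpoly_value_coset free_hpoly_value_def
      lin_ext_single[OF A.vector_space_axioms])

lemma hpoly_value_add:
  assumes "f \<in> carrier (hpoly sH)" "g \<in> carrier (hpoly sH)"
  shows "hpoly_value sA mul hact \<psi> (add (hpoly sH) f g) =
         hpoly_value sA mul hact \<psi> f + hpoly_value sA mul hact \<psi> g"
proof -
  let ?v = "free_hpoly_value sA mul hact \<psi>" and ?h = "hpoly_value sA mul hact \<psi>"
  obtain p q where "p \<in> f" "q \<in> g" using assms hpoly_nonempty by metis
  then have "p + q \<in> add (hpoly sH) f g"
    by (auto simp: hpoly_def quotient_def free_hpoly_def)
  moreover have "?v x = ?h f + ?h g" if "x \<in> add (hpoly sH) f g" for x
  proof -
    obtain p q where "p \<in> f" "q \<in> g" "x = p + q"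
      using \<open>x \<in> add (hpoly sH) f g\<close> by (auto simp: hpoly_def quotient_def free_hpoly_def)
    then show ?thesis
      using hpoly_value_representative[OF assms(1), of p \<psi>]
        hpoly_value_representative[OF assms(2), of q \<psi>]
      by (simp add: free_hpoly_value_add)
  qed
  ultimately have "?v ` add (hpoly sH) f g = {?h f + ?h g}" by (rule image_eq_singleton)
  then show ?thesis by (simp add: hpoly_value_def[of _ _ _ _ "add (hpoly sH) f g"])
qed

lemma hpoly_value_smul:
  assumes "f \<in> carrier (hpoly sH)"
  shows "hpoly_value sA mul hact \<psi> (smul (hpoly sH) c f) = sA c (hpoly_value sA mul hact \<psi> f)"
proof -
  let ?v = "free_hpoly_value sA mul hact \<psi>" and ?h = "hpoly_value sA mul hact \<psi>"
  obtain p where "p \<in> f" using assms hpoly_nonempty by metis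
  moreover have "smul (hpoly sH) c f =
      {pm_scale c p + u | p u. p \<in> f \<and> u \<in> multilinearity sH}"
    by (simp add: hpoly_def quotient_def free_hpoly_def)
  ultimately have "pm_scale c p + 0 \<in> smul (hpoly sH) c f"
    using zero_in_multilinearity[of sH] by blast
  moreover have "?v x = sA c (?h f)" if "x \<in> smul (hpoly sH) c f" for x
  proof -
    obtain q u where "q \<in> f" "u \<in> multilinearity sH" "x = pm_scale c q + u"
      using \<open>x \<in> smul (hpoly sH) c f\<close> by (auto simp: hpoly_def quotient_def free_hpoly_def)
    then show ?thesis
      using hpoly_value_representative[OF assms, of q \<psi>]
      by (simp add: free_hpoly_value_add free_hpoly_value_multilinearity)
         (simp add: free_hpoly_value_def lin_ext_pm_scale[OF A.vector_space_axioms])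
  qed
  ultimately have "?v ` smul (hpoly sH) c f = {sA c (?h f)}" by (rule image_eq_singleton)
  then show ?thesis by (simp add: hpoly_value_def[of _ _ _ _ "smul (hpoly sH) c f"])
qed

lemma free_hpoly_value_mult:
  assumes "p \<in> carrier free_hpoly"
  shows "free_hpoly_value sA mul hact \<psi> (free_hpoly_mult p q) =
         mul (free_hpoly_value sA mul hact \<psi> p) (free_hpoly_value sA mul hact \<psi> q)"
proof -
  interpret L: additive "\<lambda>a. mul a b" for b by unfold_locales (rule mul_add_left)
  interpret R: additive "\<lambda>b. mul a b" for a by unfold_locales (rule mul_add_right)
  note lin = lin_ext_sum[OF A.vector_space_axioms]
    lin_ext_pm_scale[OF A.vector_space_axioms] lin_ext_single[OF A.vector_space_axioms]
  have "length (fst k) = word_degree (snd k)" if "k \<in> Poly_Mapping.keys p" for k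
    using assms that by (auto simp: free_hpoly_def)
  then show ?thesis
    unfolding free_hpoly_value_def free_hpoly_mult_def lin_ext_def[of pm_scale]
    by (simp add: lin split_beta)
       (simp add: lin_ext_def split_beta L.sum R.sum mul_scale_left mul_scale_right
          A.scale_sum_right, subst sum.swap, simp add: mult.commute)
qed

lemma hpoly_value_mult:
  assumes "f \<in> carrier (hpoly sH)" "g \<in> carrier (hpoly sH)"
  shows "hpoly_value sA mul hact \<psi> (hpoly_mult sH f g) =
         mul (hpoly_value sA mul hact \<psi> f) (hpoly_value sA mul hact \<psi> g)"
proof -
  let ?v = "free_hpoly_value sA mul hact \<psi>" and ?h = "hpoly_value sA mul hact \<psi>"
  obtain p q where "p \<in> f" "q \<in> g" using assms hpoly_nonempty by metis
  then have "free_hpoly_mult p q + 0 \<in> hpoly_mult sH f g"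
    using zero_in_multilinearity[of sH] unfolding hpoly_mult_def by blast
  moreover have "?v x = mul (?h f) (?h g)" if "x \<in> hpoly_mult sH f g" for x
  proof -
    obtain p q r where "p \<in> f" "q \<in> g" "r \<in> multilinearity sH" "x = free_hpoly_mult p q + r"
      using \<open>x \<in> hpoly_mult sH f g\<close> by (auto simp: hpoly_mult_def)
    then show ?thesis
      using hpoly_value_representative[OF assms(1), of p \<psi>]
        hpoly_value_representative[OF assms(2), of q \<psi>]
      by (simp add: free_hpoly_value_add free_hpoly_value_multilinearity free_hpoly_value_mult)
  qed
  ultimately have "?v ` hpoly_mult sH f g = {mul (?h f) (?h g)}" by (rule image_eq_singleton)
  then show ?thesis by (simp add: hpoly_value_def[of _ _ _ _ "hpoly_mult sH f g"])
qed

end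

end

theory Submission
  imports Defs "HOL-Library.Function_Algebras" "HOL-Library.FuncSet"
begin

text \<open>
  Let \<open>d = dim A\<close>. A multilinear \<open>H\<close>-polynomial modulo identities is determined by its values on the
  \<open>n\<close>-tuples of basis vectors, so the cocharacter module embeds equivariantly into the space of
  \<open>A\<close>-valued functions on the \<open>d^n\<close> words, on which \<open>S\<^sub>n\<close> acts by permuting positions. Write the
  Young symmetrizer of \<open>T\<^sub>\<mu>\<close> as \<open>e = a b\<close>. Each summand isomorphic to \<open>M(\<mu>) = F S\<^sub>n e\<close> contains
  the image \<open>u\<close> of \<open>e\<close>, which is fixed by the row stabilizer and satisfies \<open>b u \<noteq> 0\<close>. If \<open>\<mu>\<close> has
  more than \<open>d\<close> rows, then \<open>b\<close> kills all functions on words, so the multiplicity is \<open>0\<close>. Otherwise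
  the vectors \<open>u\<close> are linearly independent functions that depend only on the number of occurrences
  of each letter in each row, which bounds the multiplicity by \<open>d (n + 1)^(d^2)\<close>; and there are at
  most \<open>(n + 1)^d\<close> partitions of \<open>n\<close> with at most \<open>d\<close> rows.
\<close>

section \<open>Quotients and isomorphisms of representations\<close>

text \<open>\<open>multiplicity\<close> counts in a decomposition selected by \<open>SOME\<close>,
  so existence must be proved before anything can be said about the selected list; this is where
  Maschke's theorem comes in. The bound is then proved for an arbitrary decomposition. The
  cocharacter module consists of cosets of cosets, with operations that behave well on a carrier
  only. The embedding into functions replaces it by a subspace of a type that is itself a vector
  space, where spans and dimensions are at hand. The vectors \<open>u\<close> are independent
  because they are nonzero and come from different summands of one direct sum. As to the constants:
  with at most \<open>d\<close> rows there are at most \<open>d * d\<close> pairs of a row and a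
  letter, each with a count in \<open>0..n\<close>, which gives \<open>(n + 1)^(d^2)\<close>; the
  factor \<open>d\<close> is the dimension of the space of values; and \<open>(n + 1)^d\<close>
  bounds the lists of \<open>d\<close> row lengths in \<open>0..n\<close>.\<close>

locale perm_rep =
  fixes n :: nat and V :: "('f::field, 'v) perm_module"
  assumes add_closed: "\<lbrakk>u \<in> carrier V; v \<in> carrier V\<rbrakk> \<Longrightarrow> add V u v \<in> carrier V"
    and zero_closed: "zero V \<in> carrier V"
    and smul_closed: "v \<in> carrier V \<Longrightarrow> smul V c v \<in> carrier V"
    and act_closed: "\<lbrakk>\<sigma> permutes {..<n}; v \<in> carrier V\<rbrakk> \<Longrightarrow> act V \<sigma> v \<in> carrier V"
    and add_assoc: "\<lbrakk>u \<in> carrier V; v \<in> carrier V; w \<in> carrier V\<rbrakk>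
      \<Longrightarrow> add V (add V u v) w = add V u (add V v w)"
    and add_commute: "\<lbrakk>u \<in> carrier V; v \<in> carrier V\<rbrakk> \<Longrightarrow> add V u v = add V v u"
    and zero_add: "v \<in> carrier V \<Longrightarrow> add V (zero V) v = v"
    and smul_add: "\<lbrakk>u \<in> carrier V; v \<in> carrier V\<rbrakk>
      \<Longrightarrow> smul V c (add V u v) = add V (smul V c u) (smul V c v)"
    and add_smul: "v \<in> carrier V \<Longrightarrow> smul V (c + d) v = add V (smul V c v) (smul V d v)"
    and smul_smul: "v \<in> carrier V \<Longrightarrow> smul V c (smul V d v) = smul V (c * d) v"
    and one_smul: "v \<in> carrier V \<Longrightarrow> smul V 1 v = v"
    and zero_smul: "v \<in> carrier V \<Longrightarrow> smul V 0 v = zero V"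
    and act_add: "\<lbrakk>\<sigma> permutes {..<n}; u \<in> carrier V; v \<in> carrier V\<rbrakk>
      \<Longrightarrow> act V \<sigma> (add V u v) = add V (act V \<sigma> u) (act V \<sigma> v)"
    and act_smul: "\<lbrakk>\<sigma> permutes {..<n}; v \<in> carrier V\<rbrakk> \<Longrightarrow> act V \<sigma> (smul V c v) = smul V c (act V \<sigma> v)"
    and act_comp: "\<lbrakk>\<sigma> permutes {..<n}; \<tau> permutes {..<n}; v \<in> carrier V\<rbrakk>
      \<Longrightarrow> act V (\<sigma> \<circ> \<tau>) v = act V \<sigma> (act V \<tau> v)"
    and act_id: "v \<in> carrier V \<Longrightarrow> act V id v = v"
begin

lemma add_zero: "v \<in> carrier V \<Longrightarrow> add V v (zero V) = v"
  by (metis add_commute zero_add zero_closed)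

text \<open>The record has no negation; inverses come from the scalar -1 through
  \<open>zero_smul\<close>.\<close>

lemma add_smul_minus_one: "v \<in> carrier V \<Longrightarrow> add V v (smul V (- 1) v) = zero V"
  by (metis add_smul one_smul zero_smul add.right_inverse)

lemma add_left_commute:
  "\<lbrakk>u \<in> carrier V; v \<in> carrier V; w \<in> carrier V\<rbrakk> \<Longrightarrow> add V u (add V v w) = add V v (add V u w)"
  by (metis add_assoc add_commute)

lemma perm_rep_submodule:
  assumes "is_submodule n V U"
  shows "perm_rep n (V\<lparr>carrier := U\<rparr>)"
proof -
  have U: "U \<subseteq> carrier V" "zero V \<in> U" "\<And>u v. u \<in> U \<Longrightarrow> v \<in> U \<Longrightarrow> add V u v \<in> U"
    "\<And>c u. u \<in> U \<Longrightarrow> smul V c u \<in> U" "\<And>\<sigma> u. \<sigma> permutes {..<n} \<Longrightarrow> u \<in> U \<Longrightarrow> act V \<sigma> u \<in> U"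
    using assms by (auto simp: is_submodule_def is_subspace_def)
  show ?thesis
    by unfold_locales
      (use U in \<open>auto simp: subset_iff intro: add_assoc add_commute zero_add smul_add add_smul
        smul_smul one_smul zero_smul act_add act_smul act_comp act_id\<close>)
qed

end

locale perm_rep_submodule = perm_rep +
  fixes U
  assumes submodule: "is_submodule n V U"
begin

lemma sub_carrier: "u \<in> U \<Longrightarrow> u \<in> carrier V"
  and sub_zero: "zero V \<in> U"
  and sub_add: "\<lbrakk>u \<in> U; v \<in> U\<rbrakk> \<Longrightarrow> add V u v \<in> U"
  and sub_smul: "u \<in> U \<Longrightarrow> smul V c u \<in> U"
  and sub_act: "\<lbrakk>\<sigma> permutes {..<n}; u \<in> U\<rbrakk> \<Longrightarrow> act V \<sigma> u \<in> U"
  using submodule by (auto simp: is_submodule_def is_subspace_def)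

lemma coset_absorb:
  assumes "c \<in> carrier V" "u \<in> U"
  shows "coset V U (add V c u) = coset V U c"
proof
  show "coset V U (add V c u) \<subseteq> coset V U c"
    unfolding coset_def using assms by (auto simp: add_assoc sub_carrier intro: sub_add)
  show "coset V U c \<subseteq> coset V U (add V c u)"
  proof
    fix x assume "x \<in> coset V U c"
    then obtain w where w: "w \<in> U" "x = add V c w" by (auto simp: coset_def)
    \<comment> \<open>The element \<open>- u + w\<close> of \<open>U\<close> shows that
      \<open>c + w\<close> lies in the coset of \<open>c + u\<close>.\<close>
    have "add V (add V c u) (add V (smul V (- 1) u) w) = add V c (add V (add V u (smul V (- 1) u)) w)"
      using assms w by (simp add: add_assoc sub_carrier add_closed smul_closed)
    also have "\<dots> = x" using assms w by (simp add: add_smul_minus_one sub_carrier zero_add)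
    finally show "x \<in> coset V U (add V c u)"
      unfolding coset_def using assms w by (metis (mono_tags, lifting) mem_Collect_eq sub_add sub_smul)
  qed
qed

lemma coset_self: "c \<in> carrier V \<Longrightarrow> c \<in> coset V U c"
  unfolding coset_def using sub_zero add_zero by force

lemma coset_zero: "coset V U (zero V) = U"
  unfolding coset_def using sub_carrier zero_add by force

text \<open>Sums and multiples in \<open>quotient\<close> are formed over all representatives.
  Moving the parts from \<open>U\<close> to the end leaves sums of this form, with \<open>g\<close>
  the identity for \<open>add\<close> and multiplication by a scalar for
  \<open>smul\<close>.\<close>

lemma coset_eq_sums:
  assumes "\<And>u. u \<in> U \<Longrightarrow> g u \<in> U" "g (zero V) = zero V"
  shows "{add V y (add V (g u) w) | u w. u \<in> U \<and> w \<in> U} = coset V U y"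
proof (intro equalityI subsetI)
  fix x assume "x \<in> {add V y (add V (g u) w) | u w. u \<in> U \<and> w \<in> U}"
  then show "x \<in> coset V U y" using assms(1) sub_add unfolding coset_def by blast
next
  fix x assume "x \<in> coset V U y"
  then obtain w where w: "w \<in> U" "x = add V y w" by (auto simp: coset_def)
  then have "x = add V y (add V (g (zero V)) w)" by (simp add: assms(2) zero_add sub_carrier)
  then show "x \<in> {add V y (add V (g u) w) | u w. u \<in> U \<and> w \<in> U}"
    using w(1) sub_zero by blast
qed

lemma quotient_add:
  assumes "c \<in> carrier V" "d \<in> carrier V"
  shows "add (quotient V U) (coset V U c) (coset V U d) = coset V U (add V c d)"
proof -
  have eq: "add V (add V c u) (add V d w) = add V (add V c d) (add V u w)" if "u \<in> U" "w \<in> U" for u w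
    using that assms by (simp add: add_assoc add_closed sub_carrier add_left_commute)
  have "add (quotient V U) (coset V U c) (coset V U d) =
      {add V (add V c u) (add V d w) | u w. u \<in> U \<and> w \<in> U}"
    unfolding quotient_def coset_def perm_module.simps by blast
  also have "\<dots> = {add V (add V c d) (add V u w) | u w. u \<in> U \<and> w \<in> U}"
    by (intro Collect_cong ex_cong1) (metis eq)
  finally show ?thesis using coset_eq_sums[of "\<lambda>u. u"] by simp
qed

lemma quotient_smul:
  assumes "c \<in> carrier V"
  shows "smul (quotient V U) a (coset V U c) = coset V U (smul V a c)"
proof -
  have eq: "add V (smul V a (add V c u)) w = add V (smul V a c) (add V (smul V a u) w)"
    if "u \<in> U" "w \<in> U" for u w
    using that assms by (simp add: add_assoc add_closed sub_carrier smul_closed smul_add)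
  have "smul (quotient V U) a (coset V U c) =
      {add V (smul V a (add V c u)) w | u w. u \<in> U \<and> w \<in> U}"
    unfolding quotient_def coset_def perm_module.simps by blast
  also have "\<dots> = {add V (smul V a c) (add V (smul V a u) w) | u w. u \<in> U \<and> w \<in> U}"
    by (intro Collect_cong ex_cong1) (metis eq)
  also have "\<dots> = coset V U (smul V a c)"
    by (rule coset_eq_sums) (metis sub_smul, metis add_zero smul_smul zero_smul zero_closed mult_zero_right)
  finally show ?thesis .
qed

lemma quotient_act:
  assumes "c \<in> carrier V" "\<sigma> permutes {..<n}"
  shows "act (quotient V U) \<sigma> (coset V U c) = coset V U (act V \<sigma> c)"
proof -
  \<comment> \<open>Invariance gives one inclusion, the inverse permutation the other; hence the
    image of a coset is a whole coset.\<close>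
  have image: "act V \<sigma> ` U = U"
  proof
    show "act V \<sigma> ` U \<subseteq> U" using assms sub_act by auto
    show "U \<subseteq> act V \<sigma> ` U"
    proof
      fix u assume "u \<in> U"
      moreover have "u = act V \<sigma> (act V (inv \<sigma>) u)"
        using act_comp[OF assms(2) permutes_inv[OF assms(2)]] \<open>u \<in> U\<close>
        by (simp add: permutes_inv_o[OF assms(2)] act_id sub_carrier)
      ultimately show "u \<in> act V \<sigma> ` U"
        using permutes_inv[OF assms(2)] sub_act by blast
    qed
  qed
  have "act V \<sigma> (add V c u) = add V (act V \<sigma> c) (act V \<sigma> u)" if "u \<in> U" for u
    using that assms by (simp add: act_add sub_carrier)
  then have "act V \<sigma> ` coset V U c = (\<lambda>u. add V (act V \<sigma> c) (act V \<sigma> u)) ` U"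
    unfolding coset_def Setcompr_eq_image image_image by (rule image_cong[OF refl])
  also have "\<dots> = (\<lambda>u. add V (act V \<sigma> c) u) ` U"
    using image by (metis image_image)
  finally show ?thesis by (simp add: quotient_def coset_def Setcompr_eq_image)
qed

lemma carrier_quotient: "carrier (quotient V U) = coset V U ` carrier V"
  by (simp add: quotient_def)

lemma zero_quotient: "zero (quotient V U) = coset V U (zero V)"
  by (simp add: quotient_def coset_zero)

lemma perm_rep_quotient: "perm_rep n (quotient V U)"
  by unfold_locales
    (auto simp: carrier_quotient zero_quotient quotient_add quotient_smul quotient_act
      add_closed zero_closed smul_closed act_closed add_assoc zero_add smul_add add_smul
      smul_smul one_smul zero_smul act_add act_smul act_comp act_id permutes_compose
      add_commute add_left_commute add_zero intro!: imageI)

end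

text \<open>The target form for transport: unlike a module of cosets, its elements live in a type
  with its own addition, so linear algebra on types applies to its submodules.\<close>

definition concrete_rep :: "('f \<Rightarrow> 'v::ab_group_add \<Rightarrow> 'v) \<Rightarrow> ((nat \<Rightarrow> nat) \<Rightarrow> 'v \<Rightarrow> 'v) \<Rightarrow> 'v set \<Rightarrow> ('f, 'v) perm_module"
  where
  "concrete_rep s \<rho> W = \<lparr>carrier = W, add = (+), zero = 0, smul = s, act = \<rho>\<rparr>"

text \<open>The condition inside \<open>isomorphic\<close> with the map exposed, so that submodules
  and decompositions can be carried along a fixed \<phi>.\<close>

definition is_iso ::
    "nat \<Rightarrow> ('f, 'v) perm_module \<Rightarrow> ('f, 'w) perm_module \<Rightarrow> ('v \<Rightarrow> 'w) \<Rightarrow> bool" where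
  "is_iso n V W \<phi> \<longleftrightarrow> bij_betw \<phi> (carrier V) (carrier W) \<and>
     (\<forall>u\<in>carrier V. \<forall>v\<in>carrier V. \<phi> (add V u v) = add W (\<phi> u) (\<phi> v)) \<and>
     (\<forall>c. \<forall>v\<in>carrier V. \<phi> (smul V c v) = smul W c (\<phi> v)) \<and>
     (\<forall>\<sigma>. \<sigma> permutes {..<n} \<longrightarrow> (\<forall>v\<in>carrier V. \<phi> (act V \<sigma> v) = act W \<sigma> (\<phi> v)))"

lemma isomorphic_iff: "isomorphic n V W \<longleftrightarrow> (\<exists>\<phi>. is_iso n V W \<phi>)"
  by (simp add: isomorphic_def is_iso_def)

section \<open>Transport of submodules and decompositions along isomorphisms\<close>

lemma is_iso_inverse:
  assumes "perm_rep n V" "is_iso n V W \<phi>"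
  shows "is_iso n W V (inv_into (carrier V) \<phi>)"
proof -
  interpret perm_rep n V by fact
  let ?\<psi> = "inv_into (carrier V) \<phi>"
  have bij: "bij_betw \<phi> (carrier V) (carrier W)" using assms(2) by (simp add: is_iso_def)
  have inj: "\<And>x y. x \<in> carrier V \<Longrightarrow> y \<in> carrier V \<Longrightarrow> \<phi> x = \<phi> y \<Longrightarrow> x = y"
    using bij by (auto simp: bij_betw_def inj_on_def)
  have mem: "?\<psi> w \<in> carrier V" "\<phi> (?\<psi> w) = w" if "w \<in> carrier W" for w
    using bij that by (auto simp: bij_betw_def intro: inv_into_into f_inv_into_f)
  have eqI: "?\<psi> w = v" if "v \<in> carrier V" "\<phi> v = w" for v w
    using bij that by (auto simp: bij_betw_def)
  show ?thesis
    unfolding is_iso_def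
    by (intro conjI ballI allI impI eqI bij_betw_inv_into[OF bij])
      (use assms(2) mem in \<open>auto simp: is_iso_def add_closed smul_closed act_closed\<close>)
qed

lemma is_iso_comp:
  assumes "is_iso n V W \<phi>" "is_iso n W Z \<psi>"
  shows "is_iso n V Z (\<psi> \<circ> \<phi>)"
proof -
  have "\<phi> v \<in> carrier W" if "v \<in> carrier V" for v
    using assms(1) that by (auto simp: is_iso_def bij_betw_def)
  then show ?thesis
    using assms by (auto simp: is_iso_def intro: bij_betw_trans)
qed

lemma is_iso_restrict:
  assumes "is_iso n V W \<phi>" "U \<subseteq> carrier V"
  shows "is_iso n (V\<lparr>carrier := U\<rparr>) (W\<lparr>carrier := \<phi> ` U\<rparr>) \<phi>"
  using assms by (auto simp: is_iso_def subset_iff intro: bij_betw_subset)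

lemma is_iso_zero:
  assumes "perm_rep n V" "perm_rep n W" "is_iso n V W \<phi>"
  shows "\<phi> (zero V) = zero W"
proof -
  interpret V: perm_rep n V by fact
  interpret W: perm_rep n W by fact
  have "\<phi> (zero V) \<in> carrier W" using assms(3) V.zero_closed by (auto simp: is_iso_def bij_betw_def)
  moreover have "\<phi> (smul V 0 (zero V)) = smul W 0 (\<phi> (zero V))"
    using assms(3) V.zero_closed by (auto simp: is_iso_def)
  ultimately show ?thesis by (simp add: V.zero_smul V.zero_closed W.zero_smul)
qed

lemma is_submodule_image:
  assumes "perm_rep n V" "perm_rep n W" "is_iso n V W \<phi>" "is_submodule n V U"
  shows "is_submodule n W (\<phi> ` U)"
proof -
  have U: "U \<subseteq> carrier V" "zero V \<in> U" "\<And>u v. u \<in> U \<Longrightarrow> v \<in> U \<Longrightarrow> add V u v \<in> U"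
    "\<And>c u. u \<in> U \<Longrightarrow> smul V c u \<in> U" "\<And>\<sigma> u. \<sigma> permutes {..<n} \<Longrightarrow> u \<in> U \<Longrightarrow> act V \<sigma> u \<in> U"
    using assms by (auto simp: is_submodule_def is_subspace_def)
  have h: "\<And>u v. u \<in> U \<Longrightarrow> v \<in> U \<Longrightarrow> add W (\<phi> u) (\<phi> v) = \<phi> (add V u v)"
    "\<And>c u. u \<in> U \<Longrightarrow> smul W c (\<phi> u) = \<phi> (smul V c u)"
    "\<And>\<sigma> u. \<sigma> permutes {..<n} \<Longrightarrow> u \<in> U \<Longrightarrow> act W \<sigma> (\<phi> u) = \<phi> (act V \<sigma> u)"
    using assms(3) U(1) by (auto simp: is_iso_def subset_iff)
  have "\<phi> ` U \<subseteq> carrier W" using assms(3) U(1) by (auto simp: is_iso_def bij_betw_def)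
  moreover have "zero W \<in> \<phi> ` U" using is_iso_zero[OF assms(1-3)] U(2) by (metis imageI)
  ultimately show ?thesis
    using U by (auto simp: is_submodule_def is_subspace_def h)
qed

lemma is_irreducible_image:
  assumes "perm_rep n V" "perm_rep n W" "is_iso n V W \<phi>" "is_irreducible n V U"
  shows "is_irreducible n W (\<phi> ` U)"
proof -
  let ?\<psi> = "inv_into (carrier V) \<phi>"
  note inv = is_iso_inverse[OF assms(1,3)]
  have U: "is_submodule n V U" "U \<noteq> {zero V}" "U \<subseteq> carrier V"
    using assms(4) by (auto simp: is_irreducible_def is_submodule_def is_subspace_def)
  have inj: "inj_on \<phi> (carrier V)" and im: "\<phi> ` carrier V = carrier W"
    using assms(3) by (auto simp: is_iso_def bij_betw_def)
  have back': "?\<psi> ` \<phi> ` T = T" if "T \<subseteq> carrier V" for T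
    using inj that by (auto simp: image_image subset_iff image_iff inv_into_f_f intro!: bexI)
  have forth': "\<phi> ` ?\<psi> ` T = T" if "T \<subseteq> carrier W" for T
    using im that by (simp add: image_inv_into_cancel)
  have zero: "\<phi> (zero V) = zero W" by (rule is_iso_zero[OF assms(1-3)])
  have "\<phi> ` U \<noteq> {zero W}"
    using back'[OF U(3)] back'[of "{zero V}"] U(2) zero perm_rep.zero_closed[OF assms(1)]
    by (metis empty_subsetI image_empty image_insert insert_subset)
  moreover have "T = {zero W} \<or> T = \<phi> ` U" if "is_submodule n W T" "T \<subseteq> \<phi> ` U" for T
  proof -
    have "is_submodule n V (?\<psi> ` T)" by (rule is_submodule_image[OF assms(2,1) inv that(1)])
    moreover have "?\<psi> ` T \<subseteq> U" using that(2) back'[OF U(3)] by blast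
    ultimately have "?\<psi> ` T = {zero V} \<or> ?\<psi> ` T = U" using assms(4) by (auto simp: is_irreducible_def)
    moreover have "\<phi> ` ?\<psi> ` T = T"
      using that(1) by (intro forth') (auto simp: is_submodule_def is_subspace_def)
    ultimately show ?thesis using zero by (metis image_empty image_insert)
  qed
  ultimately show ?thesis
    using is_submodule_image[OF assms(1-3) U(1)] by (auto simp: is_irreducible_def)
qed

lemma list_all2_mem_subset:
  assumes "list_all2 (\<in>) us Us" "\<And>U. U \<in> set Us \<Longrightarrow> U \<subseteq> K"
  shows "set us \<subseteq> K"
  using assms by (induction rule: list_all2_induct) auto

text \<open>Tuples of the image summands are exactly the entrywise images of tuples of the original
  summands, and \<phi> commutes with their sums. Injectivity of \<phi> on the carrier therefore
  carries over unique representability.\<close>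

lemma is_decomposition_image:
  assumes "perm_rep n V" "perm_rep n W" "is_iso n V W \<phi>" "is_decomposition n V Us"
  shows "is_decomposition n W (map ((`) \<phi>) Us)"
proof -
  interpret perm_rep n V by fact
  have Us: "U \<subseteq> carrier V" if "U \<in> set Us" for U
    using assms(4) that
    by (auto simp: is_decomposition_def is_irreducible_def is_submodule_def is_subspace_def)
  have inj: "inj_on \<phi> (carrier V)" and im: "\<phi> ` carrier V = carrier W"
    and hom: "\<And>u v. u \<in> carrier V \<Longrightarrow> v \<in> carrier V \<Longrightarrow> \<phi> (add V u v) = add W (\<phi> u) (\<phi> v)"
    using assms(3) by (auto simp: is_iso_def bij_betw_def)
  have fold: "foldr (add V) us (zero V) \<in> carrier V \<and>
      foldr (add W) (map \<phi> us) (zero W) = \<phi> (foldr (add V) us (zero V))"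
    if "set us \<subseteq> carrier V" for us
    using that by (induction us) (auto simp: add_closed zero_closed hom is_iso_zero[OF assms(1-3)])
  have sub: "set us \<subseteq> carrier V" if "list_all2 (\<in>) us Us" for us
    by (rule list_all2_mem_subset[OF that Us])
  have lift: "list_all2 (\<in>) (map \<phi> us) (map ((`) \<phi>) Us)" if "list_all2 (\<in>) us Us" for us
    using that by (auto simp: list_all2_conv_all_nth)
  have lower: "\<exists>us. list_all2 (\<in>) us Us \<and> ws = map \<phi> us" if "list_all2 (\<in>) ws (map ((`) \<phi>) Us)" for ws
  proof -
    have "\<forall>i<length Us. \<exists>u\<in>Us ! i. ws ! i = \<phi> u"
      using that by (auto simp: list_all2_conv_all_nth image_iff)
    then obtain u where "\<forall>i<length Us. u i \<in> Us ! i \<and> ws ! i = \<phi> (u i)" by metis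
    then show ?thesis
      using that by (intro exI[of _ "map u [0..<length Us]"])
        (auto simp: list_all2_conv_all_nth intro: nth_equalityI)
  qed
  have "\<exists>!ws. list_all2 (\<in>) ws (map ((`) \<phi>) Us) \<and> foldr (add W) ws (zero W) = w"
    if w: "w \<in> carrier W" for w
  proof -
    obtain v where v: "v \<in> carrier V" "w = \<phi> v" using w im by auto
    then have ex: "\<exists>!us. list_all2 (\<in>) us Us \<and> foldr (add V) us (zero V) = v"
      using assms(4) by (auto simp: is_decomposition_def)
    then obtain us where us: "list_all2 (\<in>) us Us" "foldr (add V) us (zero V) = v" by auto
    show ?thesis
    proof (rule ex1I[of _ "map \<phi> us"])
      show "list_all2 (\<in>) (map \<phi> us) (map ((`) \<phi>) Us) \<and> foldr (add W) (map \<phi> us) (zero W) = w"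
        using lift us v fold sub by metis
      fix ws assume ws: "list_all2 (\<in>) ws (map ((`) \<phi>) Us) \<and> foldr (add W) ws (zero W) = w"
      then obtain us' where us': "list_all2 (\<in>) us' Us" "ws = map \<phi> us'" using lower by blast
      then have "\<phi> (foldr (add V) us' (zero V)) = \<phi> v"
        using ws v fold sub by metis
      then have "foldr (add V) us' (zero V) = v"
        using inj v fold sub us'(1) by (meson inj_on_eq_iff)
      then show "ws = map \<phi> us" using ex us us' by metis
    qed
  qed
  then show ?thesis
    using assms(4) is_irreducible_image[OF assms(1-3)] by (auto simp: is_decomposition_def)
qed

text \<open>First isomorphism theorem for \<open>ev\<close>; it moves a module of cosets into a
  vector space type.\<close>

lemma (in perm_rep) is_iso_quotient_kernel:
  fixes ev :: "'v \<Rightarrow> 'w::ab_group_add"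
  assumes add: "\<And>u v. u \<in> carrier V \<Longrightarrow> v \<in> carrier V \<Longrightarrow> ev (add V u v) = ev u + ev v"
    and smul: "\<And>c v. v \<in> carrier V \<Longrightarrow> ev (smul V c v) = s c (ev v)"
    and act: "\<And>\<sigma> v. \<sigma> permutes {..<n} \<Longrightarrow> v \<in> carrier V \<Longrightarrow> ev (act V \<sigma> v) = \<rho> \<sigma> (ev v)"
    and s: "\<And>c. s c 0 = 0" and \<rho>: "\<And>\<sigma>. \<rho> \<sigma> 0 = 0"
    and U: "U = {u \<in> carrier V. ev u = 0}"
  shows "perm_rep n (quotient V U)"
    and "\<exists>\<phi>. is_iso n (quotient V U) (concrete_rep s \<rho> (ev ` carrier V)) \<phi>"
proof -
  have ev0: "ev (zero V) = 0"
    using add[OF zero_closed zero_closed] by (simp add: zero_add zero_closed)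
  interpret perm_rep_submodule n V U
    by unfold_locales
      (auto simp: U is_submodule_def is_subspace_def zero_closed add_closed smul_closed act_closed
        ev0 add smul act s \<rho>)
  show "perm_rep n (quotient V U)" by (rule perm_rep_quotient)
  \<comment> \<open>\<open>ev\<close> is constant on each coset of its kernel, so the image of a
    coset is a singleton.\<close>
  define \<phi> where "\<phi> C = the_elem (ev ` C)" for C
  have \<phi>: "\<phi> (coset V U c) = ev c" if "c \<in> carrier V" for c
  proof -
    have "ev ` coset V U c = {ev c}"
    proof (rule image_eq_singleton[of c])
      show "c \<in> coset V U c" by (rule coset_self[OF that])
      show "ev x = ev c" if "x \<in> coset V U c" for x
        using that \<open>c \<in> carrier V\<close> by (auto simp: coset_def U add)
    qed
    then show ?thesis by (simp add: \<phi>_def)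
  qed
  have eq: "coset V U c = coset V U d" if "c \<in> carrier V" "d \<in> carrier V" "ev c = ev d" for c d
  proof -
    \<comment> \<open>\<open>d - c\<close> lies in the kernel, and adding it to \<open>c\<close>
      gives \<open>d\<close>.\<close>
    let ?u = "add V d (smul V (- 1) c)"
    have "ev (add V c (smul V (- 1) c)) = 0" using that by (simp add: add_smul_minus_one ev0)
    then have "?u \<in> U" using that by (simp add: U add_closed smul_closed add)
    moreover have "add V c ?u = d"
    proof -
      have "add V c ?u = add V d (add V c (smul V (- 1) c))"
        using that by (simp add: add_left_commute smul_closed)
      then show ?thesis using that by (simp add: add_smul_minus_one add_zero)
    qed
    ultimately show ?thesis using coset_absorb[OF that(1)] by metis
  qed
  have "bij_betw \<phi> (coset V U ` carrier V) (ev ` carrier V)"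
    unfolding bij_betw_def
  proof
    show "inj_on \<phi> (coset V U ` carrier V)" by (rule inj_onI) (metis (no_types, lifting) \<phi> eq imageE)
    show "\<phi> ` coset V U ` carrier V = ev ` carrier V"
      unfolding image_image by (rule image_cong[OF refl \<phi>])
  qed
  then have "is_iso n (quotient V U) (concrete_rep s \<rho> (ev ` carrier V)) \<phi>"
    by (auto simp: is_iso_def carrier_quotient concrete_rep_def \<phi> quotient_add quotient_smul
        quotient_act add_closed smul_closed act_closed add smul act)
  then show "\<exists>\<phi>. is_iso n (quotient V U) (concrete_rep s \<rho> (ev ` carrier V)) \<phi>" by blast
qed

section \<open>Young symmetrizers\<close>

lemma pm_scale_single [simp]: "pm_scale c (Poly_Mapping.single k d) = Poly_Mapping.single k (c * d)"
  by (rule poly_mapping_eqI) (simp add: lookup_single when_def)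

lemma group_mult_single_sum:
  "group_mult (Poly_Mapping.single \<sigma> c) (\<Sum>j\<in>J. Poly_Mapping.single (g j) (b j)) =
   (\<Sum>j\<in>J. Poly_Mapping.single (\<sigma> \<circ> g j) (c * b j))"
proof -
  interpret vector_space pm_scale by (rule vector_space_pm_scale)
  show ?thesis
    by (simp add: group_mult_def lin_ext_sum[OF vector_space_pm_scale]
        lin_ext_single[OF vector_space_pm_scale] scale_sum_right)
qed

lemma group_mult_sum_left:
  "group_mult (\<Sum>i\<in>I. f i) y = (\<Sum>i\<in>I. group_mult (f i) y)"
  by (simp add: group_mult_def lin_ext_sum[OF vector_space_pm_scale])

lemma young_symmetrizer_eq:
  "young_symmetrizer \<mu> = (\<Sum>(p, q)\<in>row_stabilizer \<mu> \<times> col_stabilizer \<mu>.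
     Poly_Mapping.single (p \<circ> q) (of_int (sign q)))"
  by (simp add: young_symmetrizer_def group_mult_sum_left group_mult_single_sum sum.cartesian_product)

section \<open>Row and column stabilizers of the tableau\<close>

lemma position_unique:
  assumes "j < sum_list \<mu>" "k < sum_list \<mu>" "row_of \<mu> j = row_of \<mu> k" "col_of \<mu> j = col_of \<mu> k"
  shows "j = k"
  using assms
proof (induction \<mu> arbitrary: j k)
  case (Cons m \<mu>)
  have row: "j < m \<longleftrightarrow> k < m" using Cons.prems(3) by (cases "j < m"; cases "k < m") simp_all
  show ?case
  proof (cases "j < m")
    case True
    then have "col_of (m # \<mu>) j = j" "col_of (m # \<mu>) k = k" using row by simp_all
    then show ?thesis using Cons.prems(4) by simp
  next
    case False
    then have "\<not> k < m" using row by simp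
    with False have "j - m < sum_list \<mu>" "k - m < sum_list \<mu>"
      "row_of \<mu> (j - m) = row_of \<mu> (k - m)" "col_of \<mu> (j - m) = col_of \<mu> (k - m)"
      using Cons.prems by simp_all
    then have "j - m = k - m" by (rule Cons.IH)
    then show ?thesis using False \<open>\<not> k < m\<close> by simp
  qed
qed simp

text \<open>Such a permutation fixes every cell, because a cell is determined by its row and
  column.\<close>

lemma row_inter_col_stabilizer:
  assumes "\<pi> \<in> row_stabilizer \<mu>" "\<pi> \<in> col_stabilizer \<mu>"
  shows "\<pi> = id"
proof
  fix j
  have p: "\<pi> permutes {..<sum_list \<mu>}" using assms(1) by (simp add: row_stabilizer_def)
  show "\<pi> j = id j"
  proof (cases "j < sum_list \<mu>")
    case True
    then have "\<pi> j < sum_list \<mu>" using permutes_in_image[OF p, of j] by simp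
    then show ?thesis
      using True assms position_unique[of "\<pi> j" \<mu> j]
      by (simp add: row_stabilizer_def col_stabilizer_def)
  next
    case False
    then show ?thesis using permutes_not_in[OF p] by simp
  qed
qed

lemma
  shows finite_row_stabilizer: "finite (row_stabilizer \<mu>)"
    and finite_col_stabilizer: "finite (col_stabilizer \<mu>)"
  by (rule finite_subset[OF _ finite_permutations[of "{..<sum_list \<mu>}"]];
      auto simp: row_stabilizer_def col_stabilizer_def)+

lemma
  shows id_row_stabilizer: "id \<in> row_stabilizer \<mu>"
    and id_col_stabilizer: "id \<in> col_stabilizer \<mu>"
  by (auto simp: row_stabilizer_def col_stabilizer_def permutes_id)

lemma
  shows comp_row_stabilizer:
      "p \<in> row_stabilizer \<mu> \<Longrightarrow> p' \<in> row_stabilizer \<mu> \<Longrightarrow> p \<circ> p' \<in> row_stabilizer \<mu>"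
    and comp_col_stabilizer:
      "q \<in> col_stabilizer \<mu> \<Longrightarrow> q' \<in> col_stabilizer \<mu> \<Longrightarrow> q \<circ> q' \<in> col_stabilizer \<mu>"
proof -
  have *: "\<And>p j. p permutes {..<sum_list \<mu>} \<Longrightarrow> j < sum_list \<mu> \<Longrightarrow> p j < sum_list \<mu>"
    using permutes_in_image by (metis lessThan_iff)
  show "p \<in> row_stabilizer \<mu> \<Longrightarrow> p' \<in> row_stabilizer \<mu> \<Longrightarrow> p \<circ> p' \<in> row_stabilizer \<mu>"
    and "q \<in> col_stabilizer \<mu> \<Longrightarrow> q' \<in> col_stabilizer \<mu> \<Longrightarrow> q \<circ> q' \<in> col_stabilizer \<mu>"
    by (auto simp: row_stabilizer_def col_stabilizer_def permutes_compose *)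
qed

lemma
  shows inv_row_stabilizer: "p \<in> row_stabilizer \<mu> \<Longrightarrow> inv p \<in> row_stabilizer \<mu>"
    and inv_col_stabilizer: "q \<in> col_stabilizer \<mu> \<Longrightarrow> inv q \<in> col_stabilizer \<mu>"
proof -
  have *: "inv p j < sum_list \<mu>" "p (inv p j) = j"
    if "p permutes {..<sum_list \<mu>}" "j < sum_list \<mu>" for p j
    using permutes_in_image[OF permutes_inv[OF that(1)]] permutes_inverses[OF that(1)] that(2)
    by (metis lessThan_iff)+
  show "p \<in> row_stabilizer \<mu> \<Longrightarrow> inv p \<in> row_stabilizer \<mu>"
    and "q \<in> col_stabilizer \<mu> \<Longrightarrow> inv q \<in> col_stabilizer \<mu>"
    unfolding row_stabilizer_def col_stabilizer_def using * by (auto intro: permutes_inv) metis+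
qed

text \<open>Left multiplication by \<open>p\<close> only permutes the terms of the row symmetrizer,
  the left factor of the Young symmetrizer.\<close>

lemma row_stabilizer_young_symmetrizer:
  assumes "p \<in> row_stabilizer \<mu>"
  shows "group_mult (Poly_Mapping.single p 1) (young_symmetrizer \<mu>) = young_symmetrizer \<mu>"
proof -
  have p: "p permutes {..<sum_list \<mu>}" using assms by (simp add: row_stabilizer_def)
  have "group_mult (Poly_Mapping.single p 1) (young_symmetrizer \<mu>) =
      (\<Sum>(p', q)\<in>row_stabilizer \<mu> \<times> col_stabilizer \<mu>.
         Poly_Mapping.single (p \<circ> p' \<circ> q) (of_int (sign q)))"
    unfolding young_symmetrizer_eq case_prod_unfold group_mult_single_sum by (simp add: comp_assoc)
  also have "\<dots> = young_symmetrizer \<mu>"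
    unfolding young_symmetrizer_eq
    by (rule sum.reindex_bij_witness[of _ "\<lambda>(p', q). (inv p \<circ> p', q)" "\<lambda>(p', q). (p \<circ> p', q)"])
      (use assms p in \<open>auto simp: permutes_inv_o comp_row_stabilizer inv_row_stabilizer simp flip: comp_assoc\<close>)
  finally show ?thesis .
qed

text \<open>With \<open>e = a b\<close> for the row symmetrizer \<open>a\<close> and the column antisymmetrizer \<open>b\<close>, the coefficient
  of the identity in \<open>b a b\<close> is the order of the column stabilizer: \<open>q p q' = 1\<close> forces
  \<open>p = 1\<close> and \<open>q' = q\<^sup>-\<^sup>1\<close>.\<close>

lemma col_antisymmetrized_young_symmetrizer:
  "(\<Sum>q\<in>col_stabilizer \<mu>. pm_scale (of_int (sign q))
     (group_mult (Poly_Mapping.single q 1) (young_symmetrizer \<mu>))) \<noteq>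
   (0 :: (nat \<Rightarrow> nat) \<Rightarrow>\<^sub>0 'f::field_char_0)"
proof -
  let ?R = "row_stabilizer \<mu>" and ?C = "col_stabilizer \<mu>"
  let ?y = "young_symmetrizer \<mu> :: (nat \<Rightarrow> nat) \<Rightarrow>\<^sub>0 'f"
  have "Poly_Mapping.lookup (pm_scale (of_int (sign q)) (group_mult (Poly_Mapping.single q 1) ?y)) id = 1"
    if q: "q \<in> ?C" for q
  proof -
    have pq: "q permutes {..<sum_list \<mu>}" using q by (simp add: col_stabilizer_def)
    have coeff: "of_int (sign q) * (of_int (sign q') when q \<circ> (p \<circ> q') = id) =
        (1::'f) * of_bool (p = id \<and> q' = inv q)" if "p \<in> ?R" "q' \<in> ?C" for p q'
    proof (cases "q \<circ> (p \<circ> q') = id")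
      case True
      have pq': "q' permutes {..<sum_list \<mu>}" using that by (simp add: col_stabilizer_def)
      have "p = inv q \<circ> (q \<circ> (p \<circ> q')) \<circ> inv q'"
        by (simp add: permutes_inv_o[OF pq] permutes_inv_o[OF pq'] comp_assoc)
          (simp add: permutes_inv_o[OF pq] flip: comp_assoc)
      also have "\<dots> = inv q \<circ> inv q'" using True by simp
      finally have "p \<in> ?C"
        using q that(2) by (simp add: comp_col_stabilizer inv_col_stabilizer)
      then have p: "p = id" using row_inter_col_stabilizer that(1) by blast
      then have "q \<circ> q' = id" using True by simp
      then have "inv q \<circ> (q \<circ> q') = inv q" by simp
      then have q': "q' = inv q" by (simp add: permutes_inv_o[OF pq] flip: comp_assoc)
      have "sign q * sign q' = sign (q \<circ> q')"
        using pq pq' by (intro sign_compose[symmetric] permutes_imp_permutation[of "{..<sum_list \<mu>}"]) auto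
      then have "sign q * sign q' = 1" using \<open>q \<circ> q' = id\<close> by simp
      then have "of_int (sign q) * of_int (sign q') = (1::'f)" by (metis of_int_1 of_int_mult)
      then show ?thesis using True p q' by simp
    next
      case False
      then show ?thesis using permutes_inv_o[OF pq] by auto
    qed
    have "Poly_Mapping.lookup (pm_scale (of_int (sign q)) (group_mult (Poly_Mapping.single q 1) ?y)) id =
        (\<Sum>(p, q')\<in>?R \<times> ?C. of_int (sign q) * (of_int (sign q') when q \<circ> (p \<circ> q') = id))"
      unfolding young_symmetrizer_eq case_prod_unfold group_mult_single_sum
      by (simp add: lookup_sum lookup_single sum_distrib_left)
    also have "\<dots> = (\<Sum>(p, q')\<in>?R \<times> ?C. if (p, q') = (id, inv q) then 1 else 0)"
      by (rule sum.cong) (auto simp: coeff split: if_splits)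
    also have "\<dots> = (\<Sum>x\<in>?R \<times> ?C. if x = (id, inv q) then 1 else 0)"
      by (rule sum.cong) (simp_all split: prod.split)
    also have "\<dots> = 1"
      using q by (simp add: finite_row_stabilizer finite_col_stabilizer
          id_row_stabilizer inv_col_stabilizer)
    finally show ?thesis .
  qed
  then have "Poly_Mapping.lookup (\<Sum>q\<in>?C. pm_scale (of_int (sign q))
      (group_mult (Poly_Mapping.single q 1) ?y)) id = of_nat (card ?C)"
    by (simp add: lookup_sum)
  moreover have "card ?C \<noteq> 0" using id_col_stabilizer finite_col_stabilizer by (metis card_0_eq empty_iff)
  \<comment> \<open>Characteristic 0 keeps the order of the column stabilizer nonzero in the
    field.\<close>
  ultimately show ?thesis by (metis lookup_zero of_nat_eq_0_iff)
qed

lemma young_symmetrizer_in_irreducible_module: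
  "young_symmetrizer \<mu> \<in> carrier (irreducible_module \<mu> :: ('f::field, _) perm_module)"
proof -
  have "young_symmetrizer \<mu> =
      group_mult (Poly_Mapping.single id 1) (young_symmetrizer \<mu> :: (nat \<Rightarrow> nat) \<Rightarrow>\<^sub>0 'f)"
    by (rule row_stabilizer_young_symmetrizer[OF id_row_stabilizer, symmetric])
  then show ?thesis
    unfolding irreducible_module_def
    by (auto intro!: exI[of _ "Poly_Mapping.single id 1"] simp: permutes_id)
qed

section \<open>Decompositions of concrete representations\<close>

context vector_space
begin

text \<open>A basis of \<open>U\<close> stays independent after adding a vector of \<open>W\<close>
  outside \<open>U\<close>. The ambient space may be infinite dimensional, as the space of all
  functions on assignments is in general; finiteness comes from \<open>X\<close>.\<close>

lemma dim_less:
  assumes "subspace U" "U \<subset> W" "W \<subseteq> span X" "finite X"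
  shows "dim U < dim W"
proof -
  obtain B where B: "B \<subseteq> U" "independent B" "U \<subseteq> span B" "card B = dim U"
    using basis_exists by blast
  obtain D where D: "D \<subseteq> W" "independent D" "W \<subseteq> span D" "card D = dim W"
    using basis_exists by blast
  have "D \<subseteq> span X" using D(1) assms(3) by blast
  then have "finite D" using independent_span_bound[OF assms(4) D(2)] by simp
  obtain x where x: "x \<in> W" "x \<notin> U" using assms(2) by blast
  have "span B = U" using B assms(1) span_minimal by blast
  then have ind: "independent (insert x B)" using x B(2) by (simp add: independent_insert)
  have "insert x B \<subseteq> span D" using x(1) B(1) assms(2) D(3) by blast
  then have "finite (insert x B) \<and> card (insert x B) \<le> card D"
    using independent_span_bound[OF \<open>finite D\<close> ind] by simp
  moreover have "x \<notin> B" using B(1) x(2) by blast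
  ultimately show ?thesis using B(4) D(4) by (auto simp: card_insert_if)
qed

text \<open>Indices are counted, not vectors: independence of the family also forces
  \<open>f\<close> to be injective.\<close>

lemma card_le_if_family_independent:
  assumes "finite I" "finite X" "\<And>i. i \<in> I \<Longrightarrow> f i \<in> span X"
    and ind: "\<And>c. (\<Sum>i\<in>I. scale (c i) (f i)) = 0 \<Longrightarrow> \<forall>i\<in>I. c i = 0"
  shows "card I \<le> card X"
proof -
  have inj: "inj_on f I"
  proof (rule inj_onI, rule ccontr)
    fix i j assume ij: "i \<in> I" "j \<in> I" "f i = f j" "i \<noteq> j"
    \<comment> \<open>Equal vectors at \<open>i\<close> and \<open>j\<close> give the relation
      \<open>f i - f j = 0\<close>, with coefficient 1 at \<open>i\<close>.\<close>
    let ?c = "\<lambda>k. (if k = i then 1 else 0 :: 'a) - (if k = j then 1 else 0)"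
    have "(\<Sum>k\<in>I. scale (?c k) (f k)) = f i - f j"
      using ij assms(1) by (simp add: scale_left_diff_distrib sum_subtractf if_distrib[of "\<lambda>c. scale c _"] cong: if_cong)
    then have "\<forall>k\<in>I. ?c k = 0" using ij(3) ind[of ?c] by simp
    then show False using ij by force
  qed
  have "independent (f ` I)"
  proof (rule independent_if_scalars_zero)
    fix c x assume *: "(\<Sum>x\<in>f ` I. scale (c x) x) = 0" "x \<in> f ` I"
    then have "\<forall>i\<in>I. c (f i) = 0" using inj by (intro ind) (simp add: sum.reindex)
    then show "c x = 0" using *(2) by auto
  qed (use assms in simp)
  then have "card (f ` I) \<le> card X"
    using independent_span_bound[OF assms(2), of "f ` I"] assms(3) by auto
  then show ?thesis using inj by (simp add: card_image)
qed

end

text \<open>The action laws are imposed for all functions on \<open>nat\<close>, a form that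
  substitution satisfies; permutations of \<open>{..<n}\<close> enter through
  \<open>invariant\<close>.\<close>

locale linear_rep = vector_space s
  for s :: "'f::field_char_0 \<Rightarrow> 'v::ab_group_add \<Rightarrow> 'v" +
  fixes n :: nat and \<rho> :: "(nat \<Rightarrow> nat) \<Rightarrow> 'v \<Rightarrow> 'v"
  assumes rho_add: "\<rho> \<sigma> (u + v) = \<rho> \<sigma> u + \<rho> \<sigma> v"
    and rho_scale: "\<rho> \<sigma> (s c v) = s c (\<rho> \<sigma> v)"
    and rho_comp: "\<rho> (\<sigma> \<circ> \<tau>) v = \<rho> \<sigma> (\<rho> \<tau> v)"
    and rho_id: "\<rho> id v = v"
begin

lemma rho_zero [simp]: "\<rho> \<sigma> 0 = 0"
  using rho_add[of \<sigma> 0 0] by simp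

lemma rho_sum: "\<rho> \<sigma> (sum f I) = (\<Sum>i\<in>I. \<rho> \<sigma> (f i))"
  by (induction I rule: infinite_finite_induct) (auto simp: rho_add)

definition invariant where
  "invariant U \<longleftrightarrow> subspace U \<and> (\<forall>\<sigma>. \<sigma> permutes {..<n} \<longrightarrow> (\<forall>u\<in>U. \<rho> \<sigma> u \<in> U))"

lemma is_submodule_concrete_rep:
  "is_submodule n (concrete_rep s \<rho> W) U \<longleftrightarrow> U \<subseteq> W \<and> invariant U"
  by (auto simp: is_submodule_def is_subspace_def invariant_def concrete_rep_def subspace_def)

lemma perm_rep_concrete_rep:
  assumes "invariant W"
  shows "perm_rep n (concrete_rep s \<rho> W)"
  by unfold_locales
    (use assms in \<open>auto simp: concrete_rep_def invariant_def subspace_def rho_add rho_scale rho_comp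
      rho_id add_ac scale_right_distrib scale_left_distrib\<close>)

text \<open>Apart from \<open>U \<subseteq> W\<close>, the ambient \<open>W\<close> does not matter
  for irreducibility; so the summands of a complement remain irreducible in the whole
  module.\<close>

lemma is_irreducible_concrete_rep:
  "is_irreducible n (concrete_rep s \<rho> W) U \<longleftrightarrow> U \<subseteq> W \<and> invariant U \<and> U \<noteq> {0} \<and>
     (\<forall>T. invariant T \<and> T \<subseteq> U \<longrightarrow> T = {0} \<or> T = U)"
  unfolding is_irreducible_def is_submodule_concrete_rep by (auto simp: concrete_rep_def)

text \<open>A nonzero invariant subspace of least dimension has no proper nonzero invariant
  subspace.\<close>

lemma ex_irreducible:
  assumes "invariant W" "W \<noteq> {0}" "W \<subseteq> span X" "finite X"
  shows "\<exists>U. is_irreducible n (concrete_rep s \<rho> W) U"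
proof -
  let ?P = "\<lambda>U. invariant U \<and> U \<noteq> {0} \<and> U \<subseteq> W"
  obtain U where U: "?P U" "\<And>T. ?P T \<Longrightarrow> dim U \<le> dim T"
    using ex_has_least_nat[of ?P W dim] assms by auto
  have "T = {0} \<or> T = U" if "invariant T" "T \<subseteq> U" for T
  proof (rule ccontr)
    assume *: "\<not> (T = {0} \<or> T = U)"
    then have "dim T < dim U"
      using that U(1) assms(3) by (intro dim_less[OF _ _ _ assms(4)]) (auto simp: invariant_def)
    then show False using U(2)[of T] that * U(1) by auto
  qed
  then show ?thesis using U(1) unfolding is_irreducible_concrete_rep by blast
qed

text \<open>Maschke's argument: average an arbitrary projection onto \<open>U\<close> over the group.\<close>

lemma equivariant_projection:
  assumes "invariant U"
  obtains P where "\<And>u v. P (u + v) = P u + P v" "\<And>c v. P (s c v) = s c (P v)"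
    "\<And>v. P v \<in> U" "\<And>u. u \<in> U \<Longrightarrow> P u = u"
    "\<And>\<sigma> v. \<sigma> permutes {..<n} \<Longrightarrow> P (\<rho> \<sigma> v) = \<rho> \<sigma> (P v)"
proof -
  interpret VP: vector_space_pair s s ..
  let ?G = "{\<sigma>. \<sigma> permutes {..<n}}"
  have U: "subspace U" "\<And>\<sigma> u. \<sigma> permutes {..<n} \<Longrightarrow> u \<in> U \<Longrightarrow> \<rho> \<sigma> u \<in> U"
    using assms by (auto simp: invariant_def)
  obtain B where B: "B \<subseteq> U" "independent B" "U \<subseteq> span B"
    by (rule basis_exists[of U])
  \<comment> \<open>\<open>construct\<close> extends the identity on \<open>B\<close> to a linear
    map on the whole space with values in the span of \<open>B\<close>, so \<open>p\<close> is a
    projection onto \<open>U\<close>.\<close>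
  define p where "p = VP.construct B (\<lambda>b. b)"
  have p: "Vector_Spaces.linear s s p" unfolding p_def by (rule VP.linear_construct[OF B(2)])
  have p_add: "p (u + v) = p u + p v" and p_scale: "p (s c v) = s c (p v)" for u v c
    using p by (auto simp: Vector_Spaces.linear_iff)
  have p_in: "p v \<in> U" for v
    using VP.construct_in_span[OF B(2), of "\<lambda>b. b" v] span_minimal[OF B(1) U(1)]
    unfolding p_def by auto
  have p_id: "p u = u" if "u \<in> U" for u
  proof -
    have "u \<in> span B" using that B(3) by blast
    then show ?thesis
    proof (induction rule: span_induct_alt)
      case base
      show ?case using p_scale[of 0 0] by simp
    next
      case (step c x y)
      then show ?case unfolding p_add p_scale by (simp add: p_def VP.construct_basis[OF B(2)])
    qed
  qed
  \<comment> \<open>Each conjugate of \<open>p\<close> has values in \<open>U\<close> and fixes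
    \<open>U\<close> pointwise, hence so does the average.\<close>
  define P where "P v = s (inverse (of_nat (card ?G))) (\<Sum>\<sigma>\<in>?G. \<rho> \<sigma> (p (\<rho> (inv \<sigma>) v)))" for v
  show ?thesis
  proof
    show "P (u + v) = P u + P v" for u v
      by (simp add: P_def rho_add p_add sum.distrib scale_right_distrib)
    show "P (s c v) = s c (P v)" for c v
      by (simp add: P_def rho_scale p_scale scale_sum_right[symmetric] mult.commute)
    show "P v \<in> U" for v
      unfolding P_def by (intro subspace_scale[OF U(1)] subspace_sum[OF U(1)]) (auto intro: U(2) p_in)
    show "P u = u" if "u \<in> U" for u
    proof -
      have "\<rho> \<sigma> (p (\<rho> (inv \<sigma>) u)) = u" if "\<sigma> permutes {..<n}" for \<sigma>
      proof -
        have "p (\<rho> (inv \<sigma>) u) = \<rho> (inv \<sigma>) u"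
          by (rule p_id[OF U(2)[OF permutes_inv[OF that] \<open>u \<in> U\<close>]])
        then show ?thesis by (simp add: rho_comp[symmetric] permutes_inv_o[OF that] rho_id)
      qed
      then have "P u = s (inverse (of_nat (card ?G))) (\<Sum>\<sigma>\<in>?G. s 1 u)" by (simp add: P_def)
      also have "\<dots> = s (inverse (of_nat (card ?G)) * of_nat (card ?G)) u"
        unfolding scale_sum_left[symmetric] by simp
      \<comment> \<open>The group order \<open>n!\<close> is invertible in characteristic 0.\<close>
      finally show ?thesis by (simp add: card_permutations)
    qed
    show "P (\<rho> \<tau> v) = \<rho> \<tau> (P v)" if \<tau>: "\<tau> permutes {..<n}" for \<tau> v
    proof -
      \<comment> \<open>Replacing \<sigma> by \<open>\<tau> \<circ> \<sigma>\<close> in the sum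
        moves \<tau> from the argument to the outside.\<close>
      have "(\<Sum>\<sigma>\<in>?G. \<rho> \<sigma> (p (\<rho> (inv \<sigma>) (\<rho> \<tau> v)))) = (\<Sum>\<sigma>\<in>?G. \<rho> (\<tau> \<circ> \<sigma>) (p (\<rho> (inv \<sigma>) v)))"
      proof (rule sum.reindex_bij_witness[of _ "\<lambda>\<sigma>. \<tau> \<circ> \<sigma>" "\<lambda>\<sigma>. inv \<tau> \<circ> \<sigma>"])
        fix \<sigma> assume "\<sigma> \<in> ?G"
        then have \<sigma>: "\<sigma> permutes {..<n}" by simp
        show "\<tau> \<circ> (inv \<tau> \<circ> \<sigma>) = \<sigma>" "inv \<tau> \<circ> (\<tau> \<circ> \<sigma>) = \<sigma>"
          by (simp_all add: permutes_inv_o[OF \<tau>] flip: comp_assoc)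
        show "inv \<tau> \<circ> \<sigma> \<in> ?G" "\<tau> \<circ> \<sigma> \<in> ?G" using \<sigma> \<tau> by (simp_all add: permutes_compose permutes_inv)
        have "inv (inv \<tau> \<circ> \<sigma>) = inv \<sigma> \<circ> \<tau>"
          using o_inv_distrib[OF permutes_bij[OF permutes_inv[OF \<tau>]] permutes_bij[OF \<sigma>]]
          by (simp add: permutes_inv_inv[OF \<tau>])
        then show "\<rho> (\<tau> \<circ> (inv \<tau> \<circ> \<sigma>)) (p (\<rho> (inv (inv \<tau> \<circ> \<sigma>)) v)) = \<rho> \<sigma> (p (\<rho> (inv \<sigma>) (\<rho> \<tau> v)))"
          by (simp add: \<open>\<tau> \<circ> (inv \<tau> \<circ> \<sigma>) = \<sigma>\<close> rho_comp)
      qed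
      then show ?thesis by (simp add: P_def rho_scale rho_sum rho_comp)
    qed
  qed
qed

text \<open>Split off an irreducible \<open>U\<close>; the kernel of an equivariant projection onto
  \<open>U\<close> is an invariant complement of smaller dimension.\<close>

lemma ex_decomposition:
  assumes "invariant W" "W \<subseteq> span X" "finite X"
  shows "\<exists>Us. is_decomposition n (concrete_rep s \<rho> W) Us"
  using assms(1,2)
proof (induction "dim W" arbitrary: W rule: less_induct)
  case less
  show ?case
  proof (cases "W = {0}")
    case True
    then have "is_decomposition n (concrete_rep s \<rho> W) []"
      by (auto simp: is_decomposition_def concrete_rep_def)
    then show ?thesis ..
  next
    case False
    then obtain U where U: "is_irreducible n (concrete_rep s \<rho> W) U"
      using ex_irreducible[OF less.prems(1) _ less.prems(2) assms(3)] by auto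
    then have inv: "invariant U" "U \<subseteq> W" "U \<noteq> {0}" by (auto simp: is_irreducible_concrete_rep)
    obtain P where P: "\<And>u v. P (u + v) = P u + P v" "\<And>c v. P (s c v) = s c (P v)"
      "\<And>v. P v \<in> U" "\<And>u. u \<in> U \<Longrightarrow> P u = u"
      "\<And>\<sigma> v. \<sigma> permutes {..<n} \<Longrightarrow> P (\<rho> \<sigma> v) = \<rho> \<sigma> (P v)"
      using equivariant_projection[OF inv(1)] by blast
    have P0: "P 0 = 0" using P(1)[of 0 0] by simp
    have P_diff: "P (u - v) = P u - P v" for u v using P(1)[of "u - v" v] by (simp add: algebra_simps)
    let ?K = "{v \<in> W. P v = 0}"
    have W: "subspace W" "\<And>\<sigma> w. \<sigma> permutes {..<n} \<Longrightarrow> w \<in> W \<Longrightarrow> \<rho> \<sigma> w \<in> W"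
      using less.prems(1) by (auto simp: invariant_def)
    have K: "invariant ?K"
      using W by (auto simp: invariant_def subspace_def P P0)
    obtain u where u: "u \<in> U" "u \<noteq> 0"
      using inv(1,3) subspace_0 unfolding invariant_def by blast
    then have "u \<notin> ?K" "u \<in> W" using P(4) inv(2) by auto
    then have "?K \<subset> W" by blast
    then have "dim ?K < dim W"
      using K less.prems(2) by (intro dim_less[OF _ _ _ assms(3)]) (auto simp: invariant_def)
    then obtain Us where Us: "is_decomposition n (concrete_rep s \<rho> ?K) Us"
      using less.hyps[OF _ K] less.prems(2) by blast
    have irr: "is_irreducible n (concrete_rep s \<rho> W) T" if "T \<in> set Us" for T
      using Us that unfolding is_decomposition_def is_irreducible_concrete_rep by blast
    have sub_K: "T \<subseteq> ?K" if "T \<in> set Us" for T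
      using Us that unfolding is_decomposition_def is_irreducible_concrete_rep by blast
    have fold_K: "foldr (+) us 0 \<in> ?K" if "list_all2 (\<in>) us Us" for us
    proof -
      have "set us \<subseteq> ?K"
        by (rule list_all2_mem_subset[OF that sub_K])
      then show ?thesis
        using K by (induction us) (auto simp: invariant_def subspace_def P0)
    qed
    have "\<exists>!us. list_all2 (\<in>) us (U # Us) \<and> foldr (+) us 0 = v" if v: "v \<in> W" for v
    proof -
      have "v - P v \<in> W" using subspace_diff[OF W(1)] v P(3) inv(2) by blast
      then have "v - P v \<in> ?K" using P(3,4) by (simp add: P_diff)
      then have ex: "\<exists>!us. list_all2 (\<in>) us Us \<and> foldr (+) us 0 = v - P v"
        using Us by (auto simp: is_decomposition_def concrete_rep_def)
      then obtain us where us: "list_all2 (\<in>) us Us" "foldr (+) us 0 = v - P v" by auto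
      show ?thesis
      proof (rule ex1I[of _ "P v # us"])
        show "list_all2 (\<in>) (P v # us) (U # Us) \<and> foldr (+) (P v # us) 0 = v"
          using us P(3) by simp
        fix ws assume ws: "list_all2 (\<in>) ws (U # Us) \<and> foldr (+) ws 0 = v"
        then obtain w ws' where w: "ws = w # ws'" "w \<in> U" "list_all2 (\<in>) ws' Us"
          by (auto simp: list_all2_Cons2)
        have "v = w + foldr (+) ws' 0" using ws w(1) by simp
        \<comment> \<open>\<open>P\<close> fixes the component in \<open>U\<close> and kills the
          others, so the first component can only be \<open>P v\<close>.\<close>
        then have "P v = w" using fold_K[OF w(3)] P(4)[OF w(2)] by (simp add: P(1))
        moreover from this have "foldr (+) ws' 0 = v - P v" using \<open>v = w + _\<close> by simp
        ultimately show "ws = P v # us" using ex us w by metis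
      qed
    qed
    then have "is_decomposition n (concrete_rep s \<rho> W) (U # Us)"
      using U irr by (auto simp: is_decomposition_def concrete_rep_def)
    then show ?thesis ..
  qed
qed

text \<open>Nonzero vectors from distinct summands are independent, since 0 has a unique
  representation in the direct sum.\<close>

lemma card_summands_le:
  assumes dec: "is_decomposition n (concrete_rep s \<rho> W) Us" and W: "invariant W"
    and I: "I \<subseteq> {..<length Us}"
    and f: "\<And>i. i \<in> I \<Longrightarrow> f i \<in> Us ! i" "\<And>i. i \<in> I \<Longrightarrow> f i \<noteq> 0" "\<And>i. i \<in> I \<Longrightarrow> f i \<in> span X"
    and X: "finite X"
  shows "card I \<le> card X"
proof (rule card_le_if_family_independent[OF _ X f(3)])
  show "finite I" using I finite_subset by blast
  have inv: "invariant (Us ! i)" if "i < length Us" for i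
    using dec nth_mem[OF that] unfolding is_decomposition_def is_irreducible_concrete_rep by blast
  fix c assume c: "(\<Sum>i\<in>I. s (c i) (f i)) = 0"
  \<comment> \<open>Padding by 0 outside \<open>I\<close> turns the relation into a tuple with one
    entry per summand, to be compared with the zero tuple.\<close>
  define g where "g i = (if i \<in> I then s (c i) (f i) else 0)" for i
  let ?us = "map g [0..<length Us]" and ?zs = "map (\<lambda>_. 0 :: 'v) [0..<length Us]"
  have fold: "foldr (+) (map h [0..<length Us]) 0 = (\<Sum>i<length Us. h i)" for h :: "nat \<Rightarrow> 'v"
    by (metis atLeast0LessThan interv_sum_list_conv_sum_set_nat set_upt sum_list.eq_foldr)
  have "(\<Sum>i<length Us. g i) = 0"
    using c I by (simp add: g_def sum.If_cases Int_absorb1 flip: sum.inter_restrict)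
  then have "list_all2 (\<in>) ?us Us \<and> foldr (+) ?us 0 = 0"
    using inv f(1) I unfolding fold
    by (auto simp: list_all2_conv_all_nth g_def invariant_def intro: subspace_scale subspace_0)
  moreover have "list_all2 (\<in>) ?zs Us \<and> foldr (+) ?zs 0 = 0"
    using inv fold[of "\<lambda>_. 0"]
    by (auto simp: list_all2_conv_all_nth invariant_def intro: subspace_0)
  moreover have "\<exists>!us. list_all2 (\<in>) us Us \<and> foldr (+) us 0 = 0"
    using dec W by (auto simp: is_decomposition_def concrete_rep_def invariant_def subspace_0)
  ultimately have "?us = ?zs" by blast
  have g0: "g i = 0" if "i < length Us" for i
    using arg_cong[OF \<open>?us = ?zs\<close>, of "\<lambda>xs. xs ! i"] that by simp
  show "\<forall>i\<in>I. c i = 0"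
  proof
    fix i assume "i \<in> I"
    then show "c i = 0" using g0[of i] I f(2)[of i] by (auto simp: g_def)
  qed
qed

end

section \<open>Functions on words\<close>

text \<open>\<open>u\<close> corresponds to the Young symmetrizer itself. Its row invariance will
  confine it to a small space; its nonzero antisymmetrization gives \<open>u \<noteq> 0\<close> and
  rules out diagrams with too many rows.\<close>

lemma (in linear_rep) irreducible_module_vector:
  assumes inv: "invariant U" and iso: "isomorphic n (concrete_rep s \<rho> U) (irreducible_module \<mu>)"
    and \<mu>: "sum_list \<mu> = n"
  obtains u where "u \<in> U" "\<And>p. p \<in> row_stabilizer \<mu> \<Longrightarrow> \<rho> p u = u"
    "(\<Sum>q\<in>col_stabilizer \<mu>. s (of_int (sign q)) (\<rho> q u)) \<noteq> 0"
proof -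
  let ?M = "irreducible_module \<mu> :: ('f, _) perm_module" and ?y = "young_symmetrizer \<mu>"
  obtain \<phi> where \<phi>: "is_iso n (concrete_rep s \<rho> U) ?M \<phi>" using iso by (auto simp: isomorphic_iff)
  have U: "subspace U" "\<And>\<sigma> u. \<sigma> permutes {..<n} \<Longrightarrow> u \<in> U \<Longrightarrow> \<rho> \<sigma> u \<in> U"
    using inv by (auto simp: invariant_def)
  have bij: "bij_betw \<phi> U (carrier ?M)"
    and add: "\<And>u v. u \<in> U \<Longrightarrow> v \<in> U \<Longrightarrow> \<phi> (u + v) = \<phi> u + \<phi> v"
    and scale: "\<And>c u. u \<in> U \<Longrightarrow> \<phi> (s c u) = pm_scale c (\<phi> u)"
    and act: "\<And>\<sigma> u. \<sigma> permutes {..<n} \<Longrightarrow> u \<in> U \<Longrightarrow>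
      \<phi> (\<rho> \<sigma> u) = group_mult (Poly_Mapping.single \<sigma> 1) (\<phi> u)"
    using \<phi> by (auto simp: is_iso_def concrete_rep_def irreducible_module_def)
  have zero: "\<phi> 0 = 0" using add[of 0 0] subspace_0[OF U(1)] by simp
  have sum: "\<phi> (sum f I) = (\<Sum>i\<in>I. \<phi> (f i))" if "\<And>i. i \<in> I \<Longrightarrow> f i \<in> U" for f and I :: "(nat \<Rightarrow> nat) set"
    using that
    by (induction I rule: infinite_finite_induct) (auto simp: zero add subspace_sum[OF U(1)])
  have row: "p permutes {..<n}" if "p \<in> row_stabilizer \<mu>" for p
    using that \<mu> by (simp add: row_stabilizer_def)
  have col: "q permutes {..<n}" if "q \<in> col_stabilizer \<mu>" for q
    using that \<mu> by (simp add: col_stabilizer_def)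
  obtain u where u: "u \<in> U" "\<phi> u = ?y"
    using bij young_symmetrizer_in_irreducible_module by (metis bij_betw_def imageE)
  show ?thesis
  proof
    show "u \<in> U" by (rule u(1))
    show "\<rho> p u = u" if "p \<in> row_stabilizer \<mu>" for p
    proof -
      have "\<phi> (\<rho> p u) = \<phi> u"
        using that by (simp add: act row u row_stabilizer_young_symmetrizer)
      then show ?thesis using bij U(2) row that u(1) by (meson bij_betw_def inj_on_eq_iff)
    qed
    have mem: "s c (\<rho> q u) \<in> U" if "q \<in> col_stabilizer \<mu>" for c q
      by (rule subspace_scale[OF U(1) U(2)[OF col[OF that] u(1)]])
    have eq: "\<phi> (\<Sum>q\<in>col_stabilizer \<mu>. s (of_int (sign q)) (\<rho> q u)) =
        (\<Sum>q\<in>col_stabilizer \<mu>. pm_scale (of_int (sign q)) (group_mult (Poly_Mapping.single q 1) ?y))"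
      by (simp add: sum mem scale U(2) col u act)
    show "(\<Sum>q\<in>col_stabilizer \<mu>. s (of_int (sign q)) (\<rho> q u)) \<noteq> 0"
    proof
      assume "(\<Sum>q\<in>col_stabilizer \<mu>. s (of_int (sign q)) (\<rho> q u)) = 0"
      with eq zero show False by (simp add: col_antisymmetrized_young_symmetrizer)
    qed
  qed
qed

lemma row_of_less: "j < sum_list \<mu> \<Longrightarrow> row_of \<mu> j < length \<mu>"
proof (induction \<mu> arbitrary: j)
  case (Cons m \<mu>)
  then show ?case using Cons.IH[of "j - m"] by auto
qed simp

text \<open>No row is empty, so the first column meets all of them; its cells feed the pigeonhole
  argument on letters.\<close>

lemma ex_first_column_position:
  assumes "\<forall>k\<in>set \<mu>. 0 < k" "r < length \<mu>"
  shows "\<exists>j<sum_list \<mu>. row_of \<mu> j = r \<and> col_of \<mu> j = 0"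
  using assms
proof (induction \<mu> arbitrary: r)
  case (Cons m \<mu>)
  show ?case
  proof (cases r)
    case 0
    then show ?thesis using Cons.prems(1) by (intro exI[of _ 0]) simp
  next
    case (Suc r')
    then obtain j where "j < sum_list \<mu>" "row_of \<mu> j = r'" "col_of \<mu> j = 0"
      using Cons.IH[of r'] Cons.prems by auto
    then show ?thesis using Suc by (intro exI[of _ "m + j"]) simp
  qed
qed simp

locale basis_functions = A: finite_dimensional_vector_space sA B
  for sA :: "'f::field_char_0 \<Rightarrow> 'a::ab_group_add \<Rightarrow> 'a" and B +
  fixes n :: nat
begin

text \<open>Multilinear maps in \<open>n\<close> arguments are represented by their values on the tuples of basis
  vectors, that is on \<open>words\<close>, and set to \<open>0\<close> elsewhere.\<close>

definition words :: "(nat \<Rightarrow> 'a) set" where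
  "words = {\<psi>. (\<forall>i<n. \<psi> i \<in> B) \<and> (\<forall>i\<ge>n. \<psi> i = 0)}"

definition fscale :: "'f \<Rightarrow> ((nat \<Rightarrow> 'a) \<Rightarrow> 'a) \<Rightarrow> (nat \<Rightarrow> 'a) \<Rightarrow> 'a" where
  "fscale c F = (\<lambda>\<psi>. sA c (F \<psi>))"

text \<open>Renaming the variables of a polynomial by \<sigma> precomposes the assignment with
  \<sigma>; this is the induced left action on values.\<close>

definition subst :: "(nat \<Rightarrow> nat) \<Rightarrow> ((nat \<Rightarrow> 'a) \<Rightarrow> 'a) \<Rightarrow> (nat \<Rightarrow> 'a) \<Rightarrow> 'a" where
  "subst \<sigma> F = (\<lambda>\<psi>. F (\<psi> \<circ> \<sigma>))"

definition supported :: "((nat \<Rightarrow> 'a) \<Rightarrow> 'a) set" where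
  "supported = {F. \<forall>\<psi>. \<psi> \<notin> words \<longrightarrow> F \<psi> = 0}"

sublocale F: linear_rep fscale n subst
  by unfold_locales
    (simp_all add: fscale_def subst_def fun_eq_iff A.scale_right_distrib A.scale_left_distrib comp_assoc)

lemma sum_apply: "(\<Sum>i\<in>I. f i) \<psi> = (\<Sum>i\<in>I. f i \<psi>)" for f :: "'i \<Rightarrow> (nat \<Rightarrow> 'a) \<Rightarrow> 'a"
  by (induction I rule: infinite_finite_induct) auto

lemma finite_words: "finite words"
proof -
  \<comment> \<open>Functions in \<open>PiE\<close> are \<open>undefined\<close> off
    \<open>{..<n}\<close> and words are 0 there, so the map changes the default value.\<close>
  have "words \<subseteq> (\<lambda>f i. if i < n then f i else 0) ` (PiE {..<n} (\<lambda>_. B))"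
  proof
    fix \<psi> assume \<psi>: "\<psi> \<in> words"
    then have "\<psi> = (\<lambda>f i. if i < n then f i else 0) (restrict \<psi> {..<n})"
      by (auto simp: words_def fun_eq_iff)
    moreover have "restrict \<psi> {..<n} \<in> PiE {..<n} (\<lambda>_. B)" using \<psi> by (auto simp: words_def)
    ultimately show "\<psi> \<in> (\<lambda>f i. if i < n then f i else 0) ` (PiE {..<n} (\<lambda>_. B))" by blast
  qed
  then show ?thesis by (rule finite_subset) (simp add: finite_PiE A.finite_Basis)
qed

lemma words_comp:
  assumes "\<sigma> permutes {..<n}"
  shows "\<psi> \<circ> \<sigma> \<in> words \<longleftrightarrow> \<psi> \<in> words"
proof -
  have "\<psi> \<circ> \<sigma> \<in> words" if "\<sigma> permutes {..<n}" "\<psi> \<in> words" for \<psi> \<sigma>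
    using that permutes_in_image[OF that(1)] permutes_not_in[OF that(1)] by (auto simp: words_def)
  from this[OF assms] this[OF permutes_inv[OF assms], of "\<psi> \<circ> \<sigma>"] show ?thesis
    by (auto simp: comp_assoc permutes_inv_o[OF assms])
qed

text \<open>The indicator of one fibre of \<open>K\<close> times a vector. \<open>K\<close> is
  \<open>content\<close> for row-invariant functions and \<open>id\<close> for all supported
  functions.\<close>

definition block :: "((nat \<Rightarrow> 'a) \<Rightarrow> 'k) \<Rightarrow> 'k \<Rightarrow> 'a \<Rightarrow> (nat \<Rightarrow> 'a) \<Rightarrow> 'a" where
  "block K k a = (\<lambda>\<psi>. if \<psi> \<in> words \<and> K \<psi> = k then a else 0)"

text \<open>\<open>F\<close> is constant on the fibres of \<open>K\<close>, so it is the sum over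
  fibres of the block of its value at a representative; expanding that value in \<open>B\<close>
  gives the factor \<open>card B\<close> in the dimension bound.\<close>

lemma supported_in_span_blocks:
  assumes F: "F \<in> supported" and K: "\<And>\<psi> \<psi>'. \<lbrakk>\<psi> \<in> words; \<psi>' \<in> words; K \<psi> = K \<psi>'\<rbrakk> \<Longrightarrow> F \<psi> = F \<psi>'"
  shows "F \<in> F.span ((\<lambda>(k, b). block K k b) ` (K ` words \<times> B))" (is "_ \<in> F.span ?X")
proof -
  have block: "block K k a \<in> F.span ?X" if "k \<in> K ` words" for k a
  proof -
    have "a \<in> A.span B" using A.span_Basis by simp
    then show ?thesis
    proof (induction rule: A.span_induct_alt)
      case base
      have eq: "block K k 0 = 0" by (simp add: block_def fun_eq_iff)
      show ?case unfolding eq by (rule F.span_zero)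
    next
      case (step c b a)
      have "block K k (sA c b + a) = fscale c (block K k b) + block K k a"
        by (simp add: block_def fscale_def fun_eq_iff)
      moreover have "block K k b \<in> F.span ?X"
        using step(1) that by (intro F.span_base) auto
      ultimately show ?case using step(2) by (metis F.span_add F.span_scale)
    qed
  qed
  define r where "r k = (SOME \<psi>. \<psi> \<in> words \<and> K \<psi> = k)" for k
  have r: "r k \<in> words" "K (r k) = k" if "k \<in> K ` words" for k
    using someI_ex[of "\<lambda>\<psi>. \<psi> \<in> words \<and> K \<psi> = k"] that unfolding r_def by blast+
  have eq: "F = (\<Sum>k\<in>K ` words. block K k (F (r k)))"
  proof
    fix \<psi>
    show "F \<psi> = (\<Sum>k\<in>K ` words. block K k (F (r k))) \<psi>"
    proof (cases "\<psi> \<in> words")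
      case True
      then have "F (r (K \<psi>)) = F \<psi>" using r[of "K \<psi>"] by (intro K) auto
      then show ?thesis using True finite_words by (simp add: sum_apply block_def sum.delta)
    next
      case False
      then show ?thesis using F by (simp add: sum_apply block_def supported_def)
    qed
  qed
  show ?thesis by (subst eq) (intro F.span_sum block)
qed

lemma finite_blocks: "finite ((\<lambda>(k, b). block K k b) ` (K ` words \<times> B))"
  using finite_words A.finite_Basis by simp

lemma card_blocks_le:
  "card ((\<lambda>(k, b). block K k b) ` (K ` words \<times> B)) \<le> card (K ` words) * card B"
  using card_image_le[of "K ` words \<times> B" "\<lambda>(k, b). block K k b"] finite_words A.finite_Basis
  by (simp add: card_cartesian_product)

text \<open>\<open>restrict\<close> places all contents in one finite product that can be counted.
  For words nothing is lost: no position below \<open>n\<close> has another row or letter.\<close>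

definition content :: "nat list \<Rightarrow> (nat \<Rightarrow> 'a) \<Rightarrow> nat \<times> 'a \<Rightarrow> nat" where
  "content \<mu> \<psi> = restrict (\<lambda>(r, b). card {j \<in> {..<n}. row_of \<mu> j = r \<and> \<psi> j = b}) ({..<length \<mu>} \<times> B)"

text \<open>Each count is a number of positions below \<open>n\<close>, hence has
  \<open>n + 1\<close> possible values.\<close>

lemma card_contents_le: "card (content \<mu> ` words) \<le> (n + 1) ^ (length \<mu> * card B)"
proof -
  have "card {j \<in> {..<n}. row_of \<mu> j = r \<and> \<psi> j = b} \<le> n" for r b \<psi>
    using card_mono[of "{..<n}" "{j \<in> {..<n}. row_of \<mu> j = r \<and> \<psi> j = b}"] by auto
  then have "content \<mu> ` words \<subseteq> PiE ({..<length \<mu>} \<times> B) (\<lambda>_. {..n})"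
    by (auto simp: content_def restrict_PiE_iff image_subset_iff)
  then have "card (content \<mu> ` words) \<le> card (PiE ({..<length \<mu>} \<times> B) (\<lambda>_. {..n}))"
    using A.finite_Basis by (intro card_mono finite_PiE) auto
  then show ?thesis using A.finite_Basis by (simp add: card_PiE)
qed

text \<open>Equal contents mean that the pairs (row, letter) at the positions form the same multiset
  for both words. Matching equal pairs gives a permutation, and it preserves rows because the row is
  part of the pair.\<close>

lemma content_eq_imp_row_permutation:
  assumes \<mu>: "sum_list \<mu> = n" and "\<psi> \<in> words" "\<psi>' \<in> words" "content \<mu> \<psi> = content \<mu> \<psi>'"
  obtains p where "p \<in> row_stabilizer \<mu>" "\<psi> = \<psi>' \<circ> p"
proof -
  define f where "f \<psi> j = (row_of \<mu> j, \<psi> j)" for \<psi> :: "nat \<Rightarrow> 'a" and j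
  have count: "count (image_mset (f \<psi>) (mset_set {..<n})) (r, b) =
      (if (r, b) \<in> {..<length \<mu>} \<times> B then content \<mu> \<psi> (r, b) else 0)"
    if "\<psi> \<in> words" for \<psi> r b
  proof -
    have "count (image_mset (f \<psi>) (mset_set {..<n})) (r, b) =
        card {j \<in> {..<n}. row_of \<mu> j = r \<and> \<psi> j = b}"
      by (simp add: count_image_mset' f_def) (rule arg_cong[of _ _ card], auto)
    \<comment> \<open>Off the index set of \<open>content\<close> the count must be shown to be
      0.\<close>
    moreover have "{j \<in> {..<n}. row_of \<mu> j = r \<and> \<psi> j = b} = {}" if "\<not> (r < length \<mu> \<and> b \<in> B)"
      using that \<open>\<psi> \<in> words\<close> row_of_less[of _ \<mu>] unfolding \<mu> words_def by blast
    ultimately show ?thesis by (auto simp: content_def)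
  qed
  have "image_mset (f \<psi>) (mset_set {..<n}) = image_mset (f \<psi>') (mset_set {..<n})"
    by (rule multiset_eqI) (use assms(2-4) in \<open>auto simp: count\<close>)
  then obtain p where p: "p permutes {..<n}" "\<forall>j\<in>{..<n}. f \<psi> j = f \<psi>' (p j)"
    by (rule image_mset_eq_implies_permutes[OF finite_lessThan])
  \<comment> \<open>From \<open>n\<close> on, \<open>p\<close> fixes \<open>j\<close> and both words
    are 0.\<close>
  have "\<psi> j = \<psi>' (p j)" for j
    using p assms(2,3) permutes_not_in[OF p(1), of j] by (cases "j < n") (auto simp: f_def words_def)
  moreover have "p \<in> row_stabilizer \<mu>"
    using p by (simp add: row_stabilizer_def f_def \<mu>)
  ultimately show ?thesis by (intro that) auto
qed

lemma row_invariant_in_span_blocks: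
  assumes "sum_list \<mu> = n" "F \<in> supported" "\<And>p. p \<in> row_stabilizer \<mu> \<Longrightarrow> subst p F = F"
  shows "F \<in> F.span ((\<lambda>(k, b). block (content \<mu>) k b) ` (content \<mu> ` words \<times> B))"
proof (rule supported_in_span_blocks[OF assms(2)])
  fix \<psi> \<psi>' assume "\<psi> \<in> words" "\<psi>' \<in> words" "content \<mu> \<psi> = content \<mu> \<psi>'"
  then obtain p where p: "p \<in> row_stabilizer \<mu>" "\<psi> = \<psi>' \<circ> p"
    using content_eq_imp_row_permutation[OF assms(1)] by blast
  show "F \<psi> = F \<psi>'" using fun_cong[OF assms(3)[OF p(1)], of \<psi>'] by (simp add: subst_def p(2))
qed

text \<open>If the diagram has more than \<open>dim A\<close> rows, every word has two equal letters in the first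
  column, and their transposition makes the terms of the antisymmetrization cancel in pairs.\<close>

lemma col_antisymmetrization_eq_0:
  assumes \<mu>: "\<mu> \<in> partitions n" "card B < length \<mu>" and F: "F \<in> supported"
  shows "(\<Sum>q\<in>col_stabilizer \<mu>. fscale (of_int (sign q)) (subst q F)) = 0"
proof
  fix \<psi>
  let ?C = "col_stabilizer \<mu>"
  have n: "sum_list \<mu> = n" using \<mu>(1) by (simp add: partitions_def)
  have C: "q permutes {..<n}" if "q \<in> ?C" for q using that n by (simp add: col_stabilizer_def)
  let ?S = "\<Sum>q\<in>?C. sA (of_int (sign q)) (F (\<psi> \<circ> q))"
  have "?S = 0"
  proof (cases "\<psi> \<in> words")
    case False
    then have "F (\<psi> \<circ> q) = 0" if "q \<in> ?C" for q
      using words_comp[OF C[OF that]] F by (auto simp: supported_def)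
    then show ?thesis by simp
  next
    case True
    have "\<forall>r<length \<mu>. \<exists>j<n. row_of \<mu> j = r \<and> col_of \<mu> j = 0"
      using ex_first_column_position[of \<mu>] \<mu>(1) n by (auto simp: partitions_def)
    then obtain pos where pos: "\<And>r. r < length \<mu> \<Longrightarrow> pos r < n \<and> row_of \<mu> (pos r) = r \<and> col_of \<mu> (pos r) = 0"
      by metis
    have "(\<psi> \<circ> pos) ` {..<length \<mu>} \<subseteq> B" using True pos by (auto simp: words_def)
    then have "card ((\<psi> \<circ> pos) ` {..<length \<mu>}) \<le> card B" using A.finite_Basis by (rule card_mono[rotated])
    then have "\<not> inj_on (\<psi> \<circ> pos) {..<length \<mu>}" using \<mu>(2) by (intro pigeonhole) simp
    then obtain r r' where r: "r < length \<mu>" "r' < length \<mu>" "r \<noteq> r'" "\<psi> (pos r) = \<psi> (pos r')"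
      by (auto simp: inj_on_def)
    define t where "t = Transposition.transpose (pos r) (pos r')"
    have neq: "pos r \<noteq> pos r'" using pos[OF r(1)] pos[OF r(2)] r(3) by auto
    have t: "t permutes {..<n}" unfolding t_def using pos r by (intro permutes_swap_id) auto
    have tt: "t \<circ> t = id" by (simp add: t_def)
    have tC: "t \<in> ?C"
      using t pos r n by (auto simp: col_stabilizer_def t_def Transposition.transpose_def)
    have \<psi>t: "\<psi> \<circ> t = \<psi>" using r(4) by (auto simp: t_def Transposition.transpose_def fun_eq_iff)
    have sgn: "sign (t \<circ> q) = - sign q" if "q \<in> ?C" for q
    proof -
      have "sign (t \<circ> q) = sign t * sign q"
        using t C[OF that] by (intro sign_compose permutes_imp_permutation[of "{..<n}"]) auto
      then show ?thesis using neq by (simp add: t_def sign_swap_id)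
    qed
    have "?S = (\<Sum>q\<in>?C. sA (of_int (sign (t \<circ> q))) (F (\<psi> \<circ> (t \<circ> q))))"
      by (rule sum.reindex_bij_witness[of _ "\<lambda>q. t \<circ> q" "\<lambda>q. t \<circ> q"])
        (auto simp: comp_col_stabilizer tC tt simp flip: comp_assoc)
    also have "\<dots> = (\<Sum>q\<in>?C. - sA (of_int (sign q)) (F (\<psi> \<circ> q)))"
      by (rule sum.cong[OF refl]) (simp add: sgn \<psi>t flip: comp_assoc)
    finally have "?S = - ?S" by (simp add: sum_negf)
    then have "?S + ?S = 0" by (metis add.right_inverse)
    moreover have "sA 2 ?S = ?S + ?S" using A.scale_left_distrib[of 1 1 ?S] by simp
    ultimately have "sA 2 ?S = 0" by simp
    \<comment> \<open>The scalar 2 is nonzero in characteristic 0.\<close>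
    then show ?thesis unfolding A.scale_eq_0_iff by simp
  qed
  then show "(\<Sum>q\<in>?C. fscale (of_int (sign q)) (subst q F)) \<psi> = 0 \<psi>"
    by (simp add: sum_apply fscale_def subst_def)
qed

lemma card_isomorphic_summands_le:
  assumes W: "F.invariant W" "W \<subseteq> supported"
    and dec: "is_decomposition n (concrete_rep fscale subst W) Us" and \<mu>: "\<mu> \<in> partitions n"
  defines "I \<equiv> {i. i < length Us \<and>
    isomorphic n (concrete_rep fscale subst (Us ! i)) (irreducible_module \<mu> :: ('f, _) perm_module)}"
  shows "card I \<le> (if length \<mu> \<le> card B then card B * (n + 1) ^ (card B)\<^sup>2 else 0)"
proof -
  let ?X = "(\<lambda>(k, b). block (content \<mu>) k b) ` (content \<mu> ` words \<times> B)"
  have n: "sum_list \<mu> = n" using \<mu> by (simp add: partitions_def)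
  have Us: "F.invariant (Us ! i)" "Us ! i \<subseteq> supported" if "i < length Us" for i
  proof -
    have "is_irreducible n (concrete_rep fscale subst W) (Us ! i)"
      using dec nth_mem[OF that] unfolding is_decomposition_def by blast
    then show "F.invariant (Us ! i)" "Us ! i \<subseteq> supported"
      using W(2) unfolding F.is_irreducible_concrete_rep by auto
  qed
  have "\<forall>i\<in>I. \<exists>u. u \<in> Us ! i \<and> (\<forall>p\<in>row_stabilizer \<mu>. subst p u = u) \<and>
      (\<Sum>q\<in>col_stabilizer \<mu>. fscale (of_int (sign q)) (subst q u)) \<noteq> 0"
  proof
    fix i assume "i \<in> I"
    then have i: "i < length Us"
      "isomorphic n (concrete_rep fscale subst (Us ! i)) (irreducible_module \<mu> :: ('f, _) perm_module)"
      by (simp_all add: I_def)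
    obtain u where "u \<in> Us ! i" "\<And>p. p \<in> row_stabilizer \<mu> \<Longrightarrow> subst p u = u"
      "(\<Sum>q\<in>col_stabilizer \<mu>. fscale (of_int (sign q)) (subst q u)) \<noteq> 0"
      using F.irreducible_module_vector[OF Us(1)[OF i(1)] i(2) n] by blast
    then show "\<exists>u. u \<in> Us ! i \<and> (\<forall>p\<in>row_stabilizer \<mu>. subst p u = u) \<and>
      (\<Sum>q\<in>col_stabilizer \<mu>. fscale (of_int (sign q)) (subst q u)) \<noteq> 0" by blast
  qed
  from bchoice[OF this] obtain u where u: "\<And>i. i \<in> I \<Longrightarrow> u i \<in> Us ! i"
    "\<And>i p. i \<in> I \<Longrightarrow> p \<in> row_stabilizer \<mu> \<Longrightarrow> subst p (u i) = u i"
    "\<And>i. i \<in> I \<Longrightarrow> (\<Sum>q\<in>col_stabilizer \<mu>. fscale (of_int (sign q)) (subst q (u i))) \<noteq> 0"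
    by blast
  have supp: "u i \<in> supported" if "i \<in> I" for i
    using u(1)[OF that] Us(2)[of i] that by (auto simp: I_def)
  show ?thesis
  proof (cases "length \<mu> \<le> card B")
    case True
    have "card I \<le> card ?X"
    proof (rule F.card_summands_le[OF dec W(1), of I u])
      show "I \<subseteq> {..<length Us}" by (auto simp: I_def)
      show "u i \<noteq> 0" if "i \<in> I" for i using u(3)[OF that] by auto
      show "u i \<in> F.span ?X" if "i \<in> I" for i
        by (rule row_invariant_in_span_blocks[OF n supp[OF that] u(2)[OF that]])
    qed (auto simp: u(1) finite_blocks)
    also have "\<dots> \<le> card (content \<mu> ` words) * card B" by (rule card_blocks_le)
    also have "\<dots> \<le> (n + 1) ^ (length \<mu> * card B) * card B"
      by (rule mult_right_mono[OF card_contents_le]) simp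
    \<comment> \<open>At most \<open>card B\<close> rows with \<open>card B\<close> counts each: the
      origin of the square in the exponent.\<close>
    also have "\<dots> \<le> (n + 1) ^ (card B * card B) * card B"
      using True by (intro mult_right_mono power_increasing mult_le_mono) auto
    finally show ?thesis using True by (simp add: power2_eq_square mult.commute)
  next
    case False
    \<comment> \<open>A vector \<open>u i\<close> would have a nonzero antisymmetrization, which is
      impossible with more than \<open>card B\<close> rows.\<close>
    then have "I = {}" using u(3) col_antisymmetrization_eq_0[OF \<mu>] supp by fastforce
    then show ?thesis by simp
  qed
qed

end

section \<open>Evaluation of multilinear polynomials\<close>

lemma lin_ext_lin_ext:
  assumes "vector_space s"
  shows "lin_ext s g (lin_ext pm_scale h p) = lin_ext s (\<lambda>k. lin_ext s g (h k)) p"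
  by (simp add: lin_ext_def[of pm_scale h] lin_ext_sum[OF assms] lin_ext_pm_scale[OF assms])
    (simp add: lin_ext_def)

lemma lin_ext_single_one: "lin_ext pm_scale (\<lambda>k. Poly_Mapping.single k 1) p = p"
  by (rule poly_mapping_eqI)
    (auto simp: lin_ext_def lookup_sum lookup_single when_def in_keys_iff sum.delta)

lemma letters_map: "letters (map_nonassoc_word \<sigma> w) = map \<sigma> (letters w)"
  by (induction w) auto

text \<open>The action in \<open>free_hpoly\<close>, with projections in place of the pair pattern
  so that it can be rewritten.\<close>

definition rename ::
  "(nat \<Rightarrow> nat) \<Rightarrow> ('h hmonomial \<Rightarrow>\<^sub>0 'f::field) \<Rightarrow> 'h hmonomial \<Rightarrow>\<^sub>0 'f" where
  "rename \<sigma> = lin_ext pm_scale (\<lambda>k. Poly_Mapping.single (fst k, map_nonassoc_word \<sigma> (snd k)) 1)"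

lemma free_hpoly_simps [simp]:
  "p \<in> carrier free_hpoly \<longleftrightarrow> (\<forall>k\<in>Poly_Mapping.keys p. length (fst k) = word_degree (snd k))"
  "add free_hpoly = (+)" "zero free_hpoly = 0" "smul free_hpoly = pm_scale" "act free_hpoly = rename"
  by (auto simp: free_hpoly_def rename_def case_prod_unfold fun_eq_iff)

lemma
  shows rename_add: "rename \<sigma> (p + q) = rename \<sigma> p + rename \<sigma> q"
    and rename_diff: "rename \<sigma> (p - q) = rename \<sigma> p - rename \<sigma> q"
    and rename_pm_scale: "rename \<sigma> (pm_scale c p) = pm_scale c (rename \<sigma> p)"
    and rename_single: "rename \<sigma> (Poly_Mapping.single (hs, w) c) =
      Poly_Mapping.single (hs, map_nonassoc_word \<sigma> w) c"
  by (simp_all add: rename_def lin_ext_add[OF vector_space_pm_scale]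
      lin_ext_diff[OF vector_space_pm_scale] lin_ext_pm_scale[OF vector_space_pm_scale]
      lin_ext_single[OF vector_space_pm_scale])

lemma rename_comp: "rename (\<sigma> \<circ> \<tau>) p = rename \<sigma> (rename \<tau> p)"
  unfolding rename_def lin_ext_lin_ext[OF vector_space_pm_scale]
  by (simp add: lin_ext_single[OF vector_space_pm_scale] nonassoc_word.map_comp)

lemma rename_id: "rename id p = p"
  by (simp add: rename_def nonassoc_word.map_id lin_ext_single_one)

lemma keys_rename:
  "Poly_Mapping.keys (rename \<sigma> p) \<subseteq> (\<lambda>k. (fst k, map_nonassoc_word \<sigma> (snd k))) ` Poly_Mapping.keys p"
proof -
  have "Poly_Mapping.keys (rename \<sigma> p) \<subseteq> (\<Union>k\<in>Poly_Mapping.keys p. Poly_Mapping.keys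
      (Poly_Mapping.single (fst k, map_nonassoc_word \<sigma> (snd k)) (Poly_Mapping.lookup p k)))"
    unfolding rename_def lin_ext_def pm_scale_single mult_1_right by (rule keys_sum)
  then show ?thesis by (force split: if_splits)
qed

lemma perm_rep_free_hpoly: "perm_rep n (free_hpoly :: ('f::field, 'h hmonomial \<Rightarrow>\<^sub>0 'f) perm_module)"
proof -
  interpret vector_space "pm_scale :: 'f \<Rightarrow> ('h hmonomial \<Rightarrow>\<^sub>0 'f) \<Rightarrow> _" by (rule vector_space_pm_scale)
  show ?thesis
  proof
    fix p q :: "'h hmonomial \<Rightarrow>\<^sub>0 'f" and c :: 'f
    assume p: "p \<in> carrier free_hpoly" and "q \<in> carrier free_hpoly"
    then show "add free_hpoly p q \<in> carrier free_hpoly" using keys_add[of p q] by auto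
  next
    fix p :: "'h hmonomial \<Rightarrow>\<^sub>0 'f" and c :: 'f
    assume "p \<in> carrier free_hpoly"
    then show "smul free_hpoly c p \<in> carrier free_hpoly" by (auto simp: in_keys_iff)
  next
    fix p :: "'h hmonomial \<Rightarrow>\<^sub>0 'f" and \<sigma>
    assume "p \<in> carrier free_hpoly"
    then show "act free_hpoly \<sigma> p \<in> carrier free_hpoly"
      by (auto simp: letters_map dest!: subsetD[OF keys_rename])
  qed (simp_all add: add_ac scale_right_distrib scale_left_distrib rename_add rename_pm_scale
      rename_comp rename_id)
qed

lemma span_in_superset: "S \<subseteq> span_in V S"
  by (auto simp: span_in_def)

lemma span_in_minimal: "is_subspace V U \<Longrightarrow> S \<subseteq> U \<Longrightarrow> span_in V S \<subseteq> U"
  by (auto simp: span_in_def)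

text \<open>The vectors of the span that a given \<sigma> keeps in the span form a subspace
  containing \<open>S\<close>, hence are all of it.\<close>

lemma (in perm_rep) is_submodule_span_in:
  assumes S: "S \<subseteq> carrier V" and act: "\<And>\<sigma> x. \<sigma> permutes {..<n} \<Longrightarrow> x \<in> S \<Longrightarrow> act V \<sigma> x \<in> S"
  shows "is_submodule n V (span_in V S)"
proof -
  have carrier: "is_subspace V (carrier V)"
    by (auto simp: is_subspace_def add_closed zero_closed smul_closed)
  then have sub: "span_in V S \<subseteq> carrier V" using S by (rule span_in_minimal)
  have span: "is_subspace V (span_in V S)"
    using sub unfolding is_subspace_def by (auto simp: span_in_def is_subspace_def)
  have "act V \<sigma> u \<in> span_in V S" if \<sigma>: "\<sigma> permutes {..<n}" and u: "u \<in> span_in V S" for \<sigma> u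
  proof -
    have "act V \<sigma> (zero V) = zero V"
      using act_smul[OF \<sigma> zero_closed, of 0] zero_smul zero_closed act_closed[OF \<sigma> zero_closed] by simp
    then have "is_subspace V {v \<in> span_in V S. act V \<sigma> v \<in> span_in V S}"
      using span sub \<sigma> unfolding is_subspace_def
      by (auto simp: act_add act_smul subset_iff)
    moreover have "S \<subseteq> {v \<in> span_in V S. act V \<sigma> v \<in> span_in V S}"
      using act[OF \<sigma>] span_in_superset[of S V] by auto
    ultimately have "span_in V S \<subseteq> {v \<in> span_in V S. act V \<sigma> v \<in> span_in V S}"
      by (rule span_in_minimal)
    then show ?thesis using u by blast
  qed
  then show ?thesis using span by (simp add: is_submodule_def)
qed

text \<open>Renaming touches the word and not the entries from \<open>H\<close>, and preserves the
  degree; so each defining relation goes to the same relation for the renamed word.\<close>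

lemma is_submodule_multilinearity:
  fixes sH :: "'f::field \<Rightarrow> 'h::{ring,monoid_mult} \<Rightarrow> 'h"
  shows "is_submodule n free_hpoly (multilinearity sH)"
proof -
  interpret perm_rep n free_hpoly by (rule perm_rep_free_hpoly)
  let ?P = "\<lambda>(hs :: 'h list) (w :: nat nonassoc_word) i. length hs = word_degree w \<and> i < length hs"
  show ?thesis unfolding multilinearity_def
  proof (rule is_submodule_span_in)
    fix \<sigma> and x :: "'h hmonomial \<Rightarrow>\<^sub>0 'f"
    have P: "?P hs (map_nonassoc_word \<sigma> w) i" if "?P hs w i" for hs w i
      using that by (simp add: letters_map)
    assume "x \<in> {Poly_Mapping.single (hs[i := g + h], w) 1 - Poly_Mapping.single (hs[i := g], w) 1
         - Poly_Mapping.single (hs[i := h], w) 1 | hs w i g h. ?P hs w i} \<union>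
      {Poly_Mapping.single (hs[i := sH c h], w) 1 - Poly_Mapping.single (hs[i := h], w) c
       | hs w i c h. ?P hs w i}"
    then consider
      (add) hs w i g h where "?P hs w i" "x = Poly_Mapping.single (hs[i := g + h], w) 1 -
          Poly_Mapping.single (hs[i := g], w) 1 - Poly_Mapping.single (hs[i := h], w) 1"
    | (scale) hs w i c h where "?P hs w i"
        "x = Poly_Mapping.single (hs[i := sH c h], w) 1 - Poly_Mapping.single (hs[i := h], w) c"
      by blast
    then show "act free_hpoly \<sigma> x \<in> {Poly_Mapping.single (hs[i := g + h], w) 1
         - Poly_Mapping.single (hs[i := g], w) 1
         - Poly_Mapping.single (hs[i := h], w) 1 | hs w i g h. ?P hs w i} \<union>
      {Poly_Mapping.single (hs[i := sH c h], w) 1 - Poly_Mapping.single (hs[i := h], w) c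
       | hs w i c h. ?P hs w i}"
    proof cases
      case add
      then show ?thesis unfolding free_hpoly_simps add(2) rename_diff rename_single
        using P[OF add(1)] by blast
    next
      case scale
      then show ?thesis unfolding free_hpoly_simps scale(2) rename_diff rename_single
        using P[OF scale(1)] by blast
    qed
  qed (auto dest!: subsetD[OF keys_diff] split: if_splits)
qed

interpretation multilinearity: perm_rep_submodule n free_hpoly "multilinearity sH" for n sH
  by (intro perm_rep_submodule.intro perm_rep_free_hpoly perm_rep_submodule_axioms.intro
      is_submodule_multilinearity)

lemma perm_rep_hpoly: "perm_rep n (hpoly sH)"
  unfolding hpoly_def by (rule multilinearity.perm_rep_quotient)

lemma hmon_in_hpoly: "length hs = word_degree w \<Longrightarrow> hmon sH hs w \<in> carrier (hpoly sH)"
  unfolding hmon_def hpoly_def multilinearity.carrier_quotient by (rule imageI) simp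

lemma act_hmon:
  assumes "\<sigma> permutes {..<n}" "length hs = word_degree w"
  shows "act (hpoly sH) \<sigma> (hmon sH hs w) = hmon sH hs (map_nonassoc_word \<sigma> w)"
  unfolding hmon_def hpoly_def using assms
  by (subst multilinearity.quotient_act[where n = n]) (simp_all add: rename_single)

lemma is_submodule_multilinear_hpolys: "is_submodule n (hpoly sH) (multilinear_hpolys sH n)"
  unfolding multilinear_hpolys_def
proof (rule perm_rep.is_submodule_span_in[OF perm_rep_hpoly])
  let ?S = "{hmon sH hs w |hs w. length hs = n \<and> (\<exists>\<sigma>. \<sigma> permutes {..<n} \<and> letters w = map \<sigma> [0..<n])}"
  show "?S \<subseteq> carrier (hpoly sH)" by (auto intro!: hmon_in_hpoly)
  fix \<sigma> f assume \<sigma>: "\<sigma> permutes {..<n}" and "f \<in> ?S"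
  then obtain hs w \<tau> where w: "f = hmon sH hs w" "length hs = n" "\<tau> permutes {..<n}"
    "letters w = map \<tau> [0..<n]" by blast
  have "act (hpoly sH) \<sigma> f = hmon sH hs (map_nonassoc_word \<sigma> w)"
    using w by (simp add: act_hmon[OF \<sigma>])
  moreover have "letters (map_nonassoc_word \<sigma> w) = map (\<sigma> \<circ> \<tau>) [0..<n]"
    using w by (simp add: letters_map)
  moreover have "\<sigma> \<circ> \<tau> permutes {..<n}" using \<sigma> w(3) by (rule permutes_compose[rotated])
  ultimately show "act (hpoly sH) \<sigma> f \<in> ?S" using w(2) by blast
qed

section \<open>Evaluation on tuples of basis vectors\<close>

locale H_action_with_basis =
  generalized_H_action sH sA mul hact + basis_functions sA B n
  for sH :: "'f::field_char_0 \<Rightarrow> 'h::{ring,monoid_mult} \<Rightarrow> 'h"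
    and sA :: "'f \<Rightarrow> 'a::ab_group_add \<Rightarrow> 'a" and mul hact B n
begin

abbreviation "val \<equiv> hpoly_value sA mul hact"

abbreviation "W \<equiv> multilinear_hpolys sH n"

lemma hmon_value_map:
  "hmon_value mul hact \<psi> hs (map_nonassoc_word \<sigma> w) = hmon_value mul hact (\<psi> \<circ> \<sigma>) hs w"
  by (induction w arbitrary: hs) (simp_all add: letters_map)

lemma hmon_value_cong:
  "(\<And>i. i \<in> set (letters w) \<Longrightarrow> \<psi> i = \<psi>' i) \<Longrightarrow>
   hmon_value mul hact \<psi> hs w = hmon_value mul hact \<psi>' hs w"
proof (induction w arbitrary: hs)
  case (Prod u v)
  have "hmon_value mul hact \<psi> gs u = hmon_value mul hact \<psi>' gs u"
    "hmon_value mul hact \<psi> gs v = hmon_value mul hact \<psi>' gs v" for gs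
    using Prod.prems by (auto intro: Prod.IH)
  then show ?case by simp
qed simp

text \<open>With distinct letters, the variable \<open>i\<close> occurs in exactly one factor of
  each product, and the other factor does not depend on it.\<close>

lemma hmon_value_linear:
  "distinct (letters w) \<Longrightarrow> i \<in> set (letters w) \<Longrightarrow>
   hmon_value mul hact (\<psi>(i := sA c a + b)) hs w =
   sA c (hmon_value mul hact (\<psi>(i := a)) hs w) + hmon_value mul hact (\<psi>(i := b)) hs w"
proof (induction w arbitrary: hs)
  case (Var j)
  then show ?case by (simp add: hact_add_right hact_scale_right)
next
  case (Prod u v)
  have fresh: "hmon_value mul hact (\<psi>(i := a)) gs t = hmon_value mul hact \<psi> gs t"
    if "i \<notin> set (letters t)" for a gs t
    using that by (intro hmon_value_cong) auto
  consider "i \<in> set (letters u)" "i \<notin> set (letters v)" | "i \<notin> set (letters u)" "i \<in> set (letters v)"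
    using Prod.prems by auto
  then show ?case
  proof cases
    case 1
    then show ?thesis
      using Prod.prems(1) Prod.IH(1)[of "take (word_degree u) hs"]
      by (simp only: hmon_value.simps letters.simps distinct_append fresh simp_thms mul_add_left mul_scale_left)
  next
    case 2
    then show ?thesis
      using Prod.prems(1) Prod.IH(2)[of "drop (word_degree u) hs"]
      by (simp only: hmon_value.simps letters.simps distinct_append fresh simp_thms mul_add_right mul_scale_right)
  qed
qed

lemma W_carrier: "f \<in> W \<Longrightarrow> f \<in> carrier (hpoly sH)"
  using is_submodule_multilinear_hpolys[of n sH] by (auto simp: is_submodule_def is_subspace_def)

text \<open>Both properties hold for the generating monomials and survive sums and multiples, so one
  subspace argument yields them together.\<close>

lemma W_value:
  assumes "f \<in> W"
  shows val_cong: "(\<And>i. i < n \<Longrightarrow> \<psi> i = \<psi>' i) \<Longrightarrow> val \<psi> f = val \<psi>' f"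
    and val_linear: "i < n \<Longrightarrow> val (\<psi>(i := sA c a + b)) f = sA c (val (\<psi>(i := a)) f) + val (\<psi>(i := b)) f"
proof -
  interpret hp: perm_rep n "hpoly sH" by (rule perm_rep_hpoly)
  let ?U = "{f \<in> carrier (hpoly sH). (\<forall>\<psi> \<psi>'. (\<forall>i<n. \<psi> i = \<psi>' i) \<longrightarrow> val \<psi> f = val \<psi>' f) \<and>
    (\<forall>\<psi> i c a b. i < n \<longrightarrow>
      val (\<psi>(i := sA c a + b)) f = sA c (val (\<psi>(i := a)) f) + val (\<psi>(i := b)) f)}"
  have val_zero: "val \<psi> (zero (hpoly sH)) = 0" for \<psi>
    using hpoly_value_smul[OF hp.zero_closed, of \<psi> 0] by (simp add: hp.zero_smul hp.zero_closed)
  have "is_subspace (hpoly sH) ?U"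
    unfolding is_subspace_def
  proof (intro conjI ballI allI)
    show "?U \<subseteq> carrier (hpoly sH)" by blast
    show "zero (hpoly sH) \<in> ?U" by (simp add: hp.zero_closed val_zero)
    show "add (hpoly sH) f g \<in> ?U" if "f \<in> ?U" "g \<in> ?U" for f g
    proof -
      have fg: "f \<in> carrier (hpoly sH)" "g \<in> carrier (hpoly sH)" using that by simp_all
      show ?thesis
      proof (intro CollectI conjI allI impI)
        show "add (hpoly sH) f g \<in> carrier (hpoly sH)" by (rule hp.add_closed[OF fg])
        show "val \<psi> (add (hpoly sH) f g) = val \<psi>' (add (hpoly sH) f g)" if "\<forall>i<n. \<psi> i = \<psi>' i" for \<psi> \<psi>'
        proof -
          have "val \<psi> f = val \<psi>' f" "val \<psi> g = val \<psi>' g"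
            using \<open>f \<in> ?U\<close> \<open>g \<in> ?U\<close> that by blast+
          then show ?thesis by (simp add: hpoly_value_add[OF fg])
        qed
        show "val (\<psi>(i := sA c a + b)) (add (hpoly sH) f g) =
            sA c (val (\<psi>(i := a)) (add (hpoly sH) f g)) + val (\<psi>(i := b)) (add (hpoly sH) f g)"
          if "i < n" for \<psi> i c a b
        proof -
          have "val (\<psi>(i := sA c a + b)) f = sA c (val (\<psi>(i := a)) f) + val (\<psi>(i := b)) f"
            "val (\<psi>(i := sA c a + b)) g = sA c (val (\<psi>(i := a)) g) + val (\<psi>(i := b)) g"
            using \<open>f \<in> ?U\<close> \<open>g \<in> ?U\<close> that by blast+
          then show ?thesis by (simp only: hpoly_value_add[OF fg] A.scale_right_distrib add_ac)
        qed
      qed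
    qed
    show "smul (hpoly sH) c f \<in> ?U" if "f \<in> ?U" for c f
    proof -
      have f: "f \<in> carrier (hpoly sH)" using that by simp
      show ?thesis
      proof (intro CollectI conjI allI impI)
        show "smul (hpoly sH) c f \<in> carrier (hpoly sH)" by (rule hp.smul_closed[OF f])
        show "val \<psi> (smul (hpoly sH) c f) = val \<psi>' (smul (hpoly sH) c f)"
          if "\<forall>i<n. \<psi> i = \<psi>' i" for \<psi> \<psi>'
        proof -
          have "val \<psi> f = val \<psi>' f" using \<open>f \<in> ?U\<close> that by blast
          then show ?thesis by (simp add: hpoly_value_smul[OF f])
        qed
        show "val (\<psi>(i := sA e a + b)) (smul (hpoly sH) c f) =
            sA e (val (\<psi>(i := a)) (smul (hpoly sH) c f)) + val (\<psi>(i := b)) (smul (hpoly sH) c f)"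
          if "i < n" for \<psi> i e a b
        proof -
          have "val (\<psi>(i := sA e a + b)) f = sA e (val (\<psi>(i := a)) f) + val (\<psi>(i := b)) f"
            using \<open>f \<in> ?U\<close> that by blast
          then show ?thesis
            by (simp only: hpoly_value_smul[OF f] A.scale_right_distrib A.scale_scale mult.commute)
        qed
      qed
    qed
  qed
  moreover have "hmon sH hs w \<in> ?U"
    if "length hs = n" "\<sigma> permutes {..<n}" "letters w = map \<sigma> [0..<n]" for hs w \<sigma>
  proof -
    have val: "val \<psi> (hmon sH hs w) = hmon_value mul hact \<psi> hs w" for \<psi>
      by (simp add: hmon_def hpoly_value_coset free_hpoly_value_def
          lin_ext_single[OF A.vector_space_axioms])
    have "set (letters w) = {..<n}" "distinct (letters w)"
      using that permutes_image[OF that(2)] permutes_inj_on[OF that(2)]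
      by (auto simp: distinct_map atLeast0LessThan)
    then show ?thesis
      using that by (auto simp: val hmon_value_linear intro!: hmon_in_hpoly hmon_value_cong)
  qed
  ultimately have "W \<subseteq> ?U"
    unfolding multilinear_hpolys_def by (intro span_in_minimal) blast+
  with assms have f: "f \<in> ?U" by blast
  show "(\<And>i. i < n \<Longrightarrow> \<psi> i = \<psi>' i) \<Longrightarrow> val \<psi> f = val \<psi>' f" using f by blast
  show "i < n \<Longrightarrow> val (\<psi>(i := sA c a + b)) f = sA c (val (\<psi>(i := a)) f) + val (\<psi>(i := b)) f"
    using f by blast
qed

lemma val_act:
  assumes "f \<in> carrier (hpoly sH)" "\<sigma> permutes {..<n}"
  shows "val \<psi> (act (hpoly sH) \<sigma> f) = val (\<psi> \<circ> \<sigma>) f"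
proof -
  obtain p where p: "p \<in> carrier free_hpoly" "f = coset free_hpoly (multilinearity sH) p"
    using assms(1) by (auto simp: hpoly_def quotient_def)
  have "act (hpoly sH) \<sigma> f = coset free_hpoly (multilinearity sH) (rename \<sigma> p)"
    unfolding hpoly_def p(2) using multilinearity.quotient_act[OF p(1) assms(2), of sH] by simp
  moreover have "free_hpoly_value sA mul hact \<psi> (rename \<sigma> p) = free_hpoly_value sA mul hact (\<psi> \<circ> \<sigma>) p"
    unfolding free_hpoly_value_def rename_def lin_ext_lin_ext[OF A.vector_space_axioms]
    by (simp add: lin_ext_single[OF A.vector_space_axioms] hmon_value_map case_prod_unfold)
  ultimately show ?thesis by (simp add: p(2) hpoly_value_coset)
qed

lemma val_eq_0_if_eq_0_on_words:
  assumes f: "f \<in> W" and words: "\<And>\<psi>. \<psi> \<in> words \<Longrightarrow> val \<psi> f = 0"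
  shows "val \<psi> f = 0"
proof -
  \<comment> \<open>Basis vectors are replaced by arbitrary ones one position at a time: the first
    \<open>k\<close> values are arbitrary, the remaining ones lie in \<open>B\<close>.\<close>
  have "val \<psi> f = 0" if "k \<le> n" "\<And>i. k \<le> i \<Longrightarrow> i < n \<Longrightarrow> \<psi> i \<in> B" for k \<psi>
    using that
  proof (induction k arbitrary: \<psi>)
    case 0
    \<comment> \<open>Only values below \<open>n\<close> matter, so the assignment can be cut off to
      become a word.\<close>
    have "val \<psi> f = val (\<lambda>i. if i < n then \<psi> i else 0) f" by (rule val_cong[OF f]) simp
    also have "\<dots> = 0" using 0 by (intro words) (simp add: words_def)
    finally show ?case .
  next
    case (Suc k)
    have k: "k < n" using Suc.prems(1) by simp
    have "val (\<psi>(k := x)) f = 0" if "x \<in> A.span B" for x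
      using that
    proof (induction rule: A.span_induct_alt)
      case base
      show ?case
        \<comment> \<open>With scalar -1 and both vectors 0, the right-hand side cancels and leaves
          the value at 0.\<close>
        using val_linear[OF f k, of \<psi> "-1" 0 0]
        by (simp only: A.scale_zero_right add_0_right A.scale_minus_left A.scale_one add.left_inverse)
    next
      case (step c x y)
      have "val (\<psi>(k := x)) f = 0" using Suc.prems step(1) by (intro Suc.IH) auto
      then show ?case
        by (simp only: val_linear[OF f k] step(2) A.scale_zero_right add_0_right)
    qed
    from this[of "\<psi> k"] show ?case by (simp add: A.span_Basis)
  qed
  from this[of n \<psi>] show ?thesis by simp
qed

text \<open>The cut-off puts the image into the finite dimensional \<open>supported\<close>; it
  respects the action because permutations preserve \<open>words\<close>.\<close>

definition ev :: "('h hmonomial \<Rightarrow>\<^sub>0 'f) set \<Rightarrow> (nat \<Rightarrow> 'a) \<Rightarrow> 'a" where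
  "ev f = (\<lambda>\<psi>. if \<psi> \<in> words then val \<psi> f else 0)"

lemma
  assumes "f \<in> carrier (hpoly sH)"
  shows ev_add: "g \<in> carrier (hpoly sH) \<Longrightarrow> ev (add (hpoly sH) f g) = ev f + ev g"
    and ev_smul: "ev (smul (hpoly sH) c f) = fscale c (ev f)"
    and ev_act: "\<sigma> permutes {..<n} \<Longrightarrow> ev (act (hpoly sH) \<sigma> f) = subst \<sigma> (ev f)"
  using assms
  by (simp_all add: ev_def fun_eq_iff fscale_def subst_def hpoly_value_add hpoly_value_smul val_act words_comp)

text \<open>For multilinear polynomials, vanishing on tuples of basis vectors already means being an
  identity.\<close>

lemma kernel_ev: "W \<inter> hidentities sH sA mul hact = {f \<in> W. ev f = 0}"
  using val_eq_0_if_eq_0_on_words W_carrier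
  by (auto simp: hidentities_def ev_def fun_eq_iff)

lemma cocharacter_module_iso:
  shows perm_rep_cocharacter_module: "perm_rep n (cocharacter_module sH sA mul hact n)"
    and "\<exists>\<phi>. is_iso n (cocharacter_module sH sA mul hact n) (concrete_rep fscale subst (ev ` W)) \<phi>"
proof -
  interpret hp: perm_rep n "hpoly sH" by (rule perm_rep_hpoly)
  interpret W: perm_rep n "(hpoly sH)\<lparr>carrier := W\<rparr>"
    by (rule hp.perm_rep_submodule[OF is_submodule_multilinear_hpolys])
  let ?U = "W \<inter> hidentities sH sA mul hact" and ?W = "(hpoly sH)\<lparr>carrier := W\<rparr>"
  have hom: "ev (add ?W f g) = ev f + ev g" "ev (smul ?W c f) = fscale c (ev f)"
    "\<sigma> permutes {..<n} \<Longrightarrow> ev (act ?W \<sigma> f) = subst \<sigma> (ev f)"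
    if "f \<in> carrier ?W" "g \<in> carrier ?W" for f g c \<sigma>
    using that by (simp_all add: ev_add ev_smul ev_act W_carrier)
  have U: "?U = {f \<in> carrier ?W. ev f = 0}" by (simp add: kernel_ev)
  show "perm_rep n (cocharacter_module sH sA mul hact n)"
    unfolding cocharacter_module_def
    by (rule W.is_iso_quotient_kernel(1)[OF hom(1) hom(2) hom(3) F.scale_zero_right F.rho_zero U])
  show "\<exists>\<phi>. is_iso n (cocharacter_module sH sA mul hact n) (concrete_rep fscale subst (ev ` W)) \<phi>"
    using W.is_iso_quotient_kernel(2)[OF hom(1) hom(2) hom(3) F.scale_zero_right F.rho_zero U]
    unfolding cocharacter_module_def by simp
qed

lemma invariant_ev_W: "F.invariant (ev ` W)"
proof -
  have W: "is_submodule n (hpoly sH) W" by (rule is_submodule_multilinear_hpolys)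
  have "F.subspace (ev ` W)"
  proof (rule F.subspaceI)
    have "zero (hpoly sH) \<in> W" using W by (simp add: is_submodule_def is_subspace_def)
    moreover have "ev (zero (hpoly sH)) = 0"
      using ev_smul[OF W_carrier, of "zero (hpoly sH)" 0] \<open>zero (hpoly sH) \<in> W\<close>
        perm_rep.zero_smul[OF perm_rep_hpoly W_carrier, of "zero (hpoly sH)"] by simp
    ultimately show "0 \<in> ev ` W" by (metis imageI)
  next
    fix F G assume "F \<in> ev ` W" "G \<in> ev ` W"
    then show "F + G \<in> ev ` W"
      using W by (auto simp: ev_add[symmetric] W_carrier is_submodule_def is_subspace_def)
  next
    fix c F assume "F \<in> ev ` W"
    then show "fscale c F \<in> ev ` W"
      using W by (auto simp: ev_smul[symmetric] W_carrier is_submodule_def is_subspace_def)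
  qed
  then show ?thesis
    using W by (auto simp: F.invariant_def ev_act[symmetric] W_carrier is_submodule_def)
qed

text \<open>\<phi> is used in both directions: a decomposition of the function space is carried
  back, so that the choice in \<open>multiplicity\<close> yields a genuine decomposition; the chosen
  one is then carried forward and its summands are counted there.\<close>

lemma multiplicity_le:
  assumes "\<mu> \<in> partitions n"
  shows "multiplicity n (cocharacter_module sH sA mul hact n) (irreducible_module \<mu> :: ('f, _) perm_module)
    \<le> (if length \<mu> \<le> card B then card B * (n + 1) ^ (card B)\<^sup>2 else 0)"
proof -
  let ?V = "cocharacter_module sH sA mul hact n" and ?C = "concrete_rep fscale subst (ev ` W)"
  let ?M = "irreducible_module \<mu> :: ('f, _) perm_module"
  note V = perm_rep_cocharacter_module and C = F.perm_rep_concrete_rep[OF invariant_ev_W]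
  obtain \<phi> where \<phi>: "is_iso n ?V ?C \<phi>" using cocharacter_module_iso(2) by blast
  have supp: "ev ` W \<subseteq> supported" by (auto simp: ev_def supported_def)
  \<comment> \<open>With \<open>id\<close> every word is its own fibre, so the blocks span all of
    \<open>supported\<close>; this gives the finite spanning set for Maschke's theorem.\<close>
  have "ev ` W \<subseteq> F.span ((\<lambda>(k, b). block id k b) ` (id ` words \<times> B))"
  proof
    fix f assume "f \<in> ev ` W"
    then have "f \<in> supported" using supp by blast
    then show "f \<in> F.span ((\<lambda>(k, b). block id k b) ` (id ` words \<times> B))"
      by (rule supported_in_span_blocks) simp
  qed
  from F.ex_decomposition[OF invariant_ev_W this finite_blocks]
  obtain Us' where "is_decomposition n ?C Us'" by blast
  from is_decomposition_image[OF C V is_iso_inverse[OF V \<phi>] this]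
  have ex: "\<exists>Us. is_decomposition n ?V Us" ..
  define Us where "Us = (SOME Us. is_decomposition n ?V Us)"
  have Us: "is_decomposition n ?V Us" unfolding Us_def by (rule someI_ex[OF ex])
  have dec: "is_decomposition n ?C (map ((`) \<phi>) Us)" by (rule is_decomposition_image[OF V C \<phi> Us])
  let ?I = "{i. i < length (map ((`) \<phi>) Us) \<and>
    isomorphic n (concrete_rep fscale subst (map ((`) \<phi>) Us ! i)) ?M}"
  \<comment> \<open>A summand is isomorphic to its image under \<phi>, so its isomorphism with
    \<open>?M\<close> passes to the image.\<close>
  have "{i. i < length Us \<and> isomorphic n (?V\<lparr>carrier := Us ! i\<rparr>) ?M} \<subseteq> ?I"
  proof safe
    fix i assume i: "i < length Us" "isomorphic n (?V\<lparr>carrier := Us ! i\<rparr>) ?M"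
    then show "i < length (map ((`) \<phi>) Us)" by simp
    have sub: "is_submodule n ?V (Us ! i)"
      using Us nth_mem[OF i(1)] unfolding is_decomposition_def is_irreducible_def by blast
    then have "is_iso n (?V\<lparr>carrier := Us ! i\<rparr>) (?C\<lparr>carrier := \<phi> ` (Us ! i)\<rparr>) \<phi>"
      by (intro is_iso_restrict[OF \<phi>]) (auto simp: is_submodule_def is_subspace_def)
    then have "is_iso n (?V\<lparr>carrier := Us ! i\<rparr>) (concrete_rep fscale subst (\<phi> ` (Us ! i))) \<phi>"
      by (simp add: concrete_rep_def)
    from is_iso_inverse[OF perm_rep.perm_rep_submodule[OF V sub] this] i
    show "isomorphic n (concrete_rep fscale subst (map ((`) \<phi>) Us ! i)) ?M"
      by (auto simp: isomorphic_iff intro: is_iso_comp)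
  qed
  then have "card {i. i < length Us \<and> isomorphic n (?V\<lparr>carrier := Us ! i\<rparr>) ?M} \<le> card ?I"
    by (intro card_mono) auto
  also have "\<dots> \<le> (if length \<mu> \<le> card B then card B * (n + 1) ^ (card B)\<^sup>2 else 0)"
    by (rule card_isomorphic_summands_le[OF invariant_ev_W supp dec assms])
  finally show ?thesis
    by (simp add: multiplicity_def length_filter_conv_card flip: Us_def)
qed

end

section \<open>The colength bound\<close>

lemma length_le_sum_list: "\<forall>k\<in>set \<mu>. 0 < k \<Longrightarrow> length \<mu> \<le> sum_list \<mu>" for \<mu> :: "nat list"
  by (induction \<mu>) auto

lemma finite_partitions: "finite (partitions n)"
  by (rule finite_subset[OF _ finite_lists_length_le[of "{..n}" n]])
    (auto simp: partitions_def length_le_sum_list intro: member_le_sum_list)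

text \<open>Padding with zeros to length \<open>d\<close> is injective: parts are positive, so the
  zeros reveal the length. All \<open>d\<close> entries lie in \<open>0..n\<close>.\<close>

lemma card_partitions_bounded_length:
  "card {\<mu> \<in> partitions n. length \<mu> \<le> d} \<le> (n + 1) ^ d"
proof -
  let ?P = "{\<mu> \<in> partitions n. length \<mu> \<le> d}"
  define pad where "pad \<mu> = restrict (\<lambda>i. if i < length \<mu> then \<mu> ! i else 0) {..<d}" for \<mu> :: "nat list"
  have pos: "0 < \<mu> ! i" if "\<mu> \<in> ?P" "i < length \<mu>" for \<mu> i
    using that by (auto simp: partitions_def)
  have len: "length \<mu> \<le> length \<nu>" if "\<mu> \<in> ?P" "\<nu> \<in> ?P" "pad \<mu> = pad \<nu>" for \<mu> \<nu>
  proof (rule ccontr)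
    assume "\<not> length \<mu> \<le> length \<nu>"
    then show False
      using fun_cong[OF that(3), of "length \<nu>"] pos[OF that(1), of "length \<nu>"] that(1)
      by (simp add: pad_def)
  qed
  have "inj_on pad ?P"
  proof (rule inj_onI)
    fix \<mu> \<nu> assume *: "\<mu> \<in> ?P" "\<nu> \<in> ?P" "pad \<mu> = pad \<nu>"
    then have l: "length \<mu> = length \<nu>" using len[of \<mu> \<nu>] len[of \<nu> \<mu>] by simp
    have "\<mu> ! i = \<nu> ! i" if "i < length \<mu>" for i
      using fun_cong[OF *(3), of i] that l *(1) by (simp add: pad_def)
    then show "\<mu> = \<nu>" using l by (intro nth_equalityI)
  qed
  moreover have "\<mu> ! i \<le> n" if "\<mu> \<in> ?P" "i < length \<mu>" for \<mu> i
    using that member_le_sum_list[of "\<mu> ! i" \<mu>] by (auto simp: partitions_def)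
  then have "pad ` ?P \<subseteq> PiE {..<d} (\<lambda>_. {..n})"
    by (auto simp: pad_def restrict_PiE_iff image_subset_iff)
  ultimately have "card ?P \<le> card (PiE {..<d} (\<lambda>_. {..n}))"
    by (intro card_inj_on_le[of pad]) (auto intro: finite_PiE)
  then show ?thesis by (simp add: card_PiE)
qed

theorem theorem5p5:
  fixes sH :: "'f::field_char_0 \<Rightarrow> 'h::{ring,monoid_mult} \<Rightarrow> 'h"
    and sA :: "'f \<Rightarrow> 'a::ab_group_add \<Rightarrow> 'a"
    and mul :: "'a \<Rightarrow> 'a \<Rightarrow> 'a"
    and hact :: "'h \<Rightarrow> 'a \<Rightarrow> 'a"
    and Basis :: "'a set"
    and n :: nat
  assumes "generalized_H_action sH sA mul hact"
    and "finite_dimensional_vector_space sA Basis"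
    and "n \<ge> 1"
  shows "colength sH sA mul hact n
    \<le> vector_space.dim sA UNIV *
       (n + 1) ^ ((vector_space.dim sA UNIV)\<^sup>2 + vector_space.dim sA UNIV)"
proof -
  interpret H_action_with_basis sH sA mul hact Basis n
    by (intro H_action_with_basis.intro basis_functions.intro assms)
  let ?d = "card Basis"
  have "colength sH sA mul hact n \<le>
      (\<Sum>\<mu>\<in>partitions n. if length \<mu> \<le> ?d then ?d * (n + 1) ^ ?d\<^sup>2 else 0)"
    unfolding colength_def by (rule sum_mono) (rule multiplicity_le)
  \<comment> \<open>Each partition with at most \<open>?d\<close> rows contributes the same amount,
    the others nothing.\<close>
  also have "\<dots> = card {\<mu> \<in> partitions n. length \<mu> \<le> ?d} * (?d * (n + 1) ^ ?d\<^sup>2)"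
    by (simp add: finite_partitions sum.If_cases Int_def)
  also have "\<dots> \<le> (n + 1) ^ ?d * (?d * (n + 1) ^ ?d\<^sup>2)"
    by (rule mult_right_mono[OF card_partitions_bounded_length]) simp
  also have "\<dots> = ?d * (n + 1) ^ (?d\<^sup>2 + ?d)" by (simp add: power_add)
  finally show ?thesis by (simp add: A.dim_UNIV)
qed

end
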